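(* Let $\mathcal{W}$ be a reflection group of type $A_n$, $B_n$, or $D_n$, let $\chi(t)$ be the characteristic polynomial of the associated reflection arrangement, and let $\mathcal{C}$ be a fundamental chamber of $\mathcal{W}$. For a generic point $x\in\mathcal{C}$ and every integer $k\ge 0$, the number of group elements $g\in\mathcal{W}$ such that the projection $\pi_{\mathcal{C}}(gx)$ is $k$-dimensional is equal to the absolute value of the coefficient of $t^k$ in $\chi(t)$.
   Context: Groups: $A_n$ is the group of all permutations of the coordinates of $\mathbb{R}^{n+1}$, with mirrors $\{x_i=x_j\}$, $1\le i<j\le n+1$. $B_n$ is the group of all signed permutations of the coordinates of $\mathbb{R}^n$, with mirrors $\{x_i=x_j\}$, $\{x_i=-x_j\}$ ($1\le i<j\le n$) and $\{x_k=0\}$ ($1\le k\le n$). $D_n$ is the subgroup of $B_n$ of signed permutations with an even number of sign changes, with mirrors $\{x_i=x_j\}$, $\{x_i=-x_j\}$ ($1\le i<j\le n$). The reflection arrangement of a finite reflection group $\mathcal{W}$ acting on $\mathbb{R}^N$ is the collection of all mirrors (fixed hyperplanes) of reflections in $\mathcal{W}$. A fundamental chamber of $\mathcal{W}$ is the closure of a connected component (region) of the complement of the union of all these hyperplanes; it is a polyhedral cone. Characteristic polynomial: for a finite collection $\mathcal{A}$ of linear hyperplanes in $\mathbb{R}^N$, let $L(\mathcal{A})$ be the set of all intersections of subcollections of $\mathcal{A}$ (including $\mathbb{R}^N$ as the empty intersection), ordered by reverse inclusion. Define $\mu:L(\mathcal{A})\to\mathbb{Z}$ by $\mu(\mathbb{R}^N)=1$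 and $\sum_{z\le y}\mu(z)=0$ for all $y\ne\mathbb{R}^N$. Then $\chi_{\mathcal{A}}(t)=\sum_{y\in L(\mathcal{A})}\mu(y)\,t^{\dim y}$. Projection: $\pi_{\mathcal{C}}(y)$ is the orthogonal (Euclidean nearest-point) projection of $y\in\mathbb{R}^N$ onto $\mathcal{C}$. The projection $\pi_{\mathcal{C}}(y)$ is called $k$-dimensional if it lies in the relative interior of a $k$-dimensional face of $\mathcal{C}$ (where $\mathcal{C}$ itself is a face). "For a generic point $x\in\mathcal{C}$" means: for all $x\in\mathcal{C}$ outside some set of Lebesgue measure zero. *)

theory Defs
  imports "HOL-Analysis.Analysis" "HOL-Computational_Algebra.Polynomial"
    "HOL-Combinatorics.Permutations"
begin

text \<open>
  A group is represented by the set of its elements, viewed as maps on \<open>real ^ 'n\<close>.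
  The coordinates are indexed by the finite type \<open>'n\<close>, so the ranks are as follows:
  \<open>type_A\<close> is \<open>A\<^sub>n\<close> for \<open>n + 1 = CARD('n)\<close>, whereas \<open>type_B\<close> and \<open>type_D\<close> are
  \<open>B\<^sub>n\<close> and \<open>D\<^sub>n\<close> for \<open>n = CARD('n)\<close>.
\<close>

definition signed_perm :: "('n \<Rightarrow> real) \<Rightarrow> ('n \<Rightarrow> 'n) \<Rightarrow> real ^ 'n \<Rightarrow> real ^ 'n" where
  "signed_perm s p x = (\<chi> i. s i * x $ p i)"

definition type_A :: "(real ^ 'n \<Rightarrow> real ^ 'n) set" where
  "type_A = {signed_perm (\<lambda>_. 1) p | p. p permutes UNIV}"

definition type_B :: "(real ^ 'n \<Rightarrow> real ^ 'n) set" where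
  "type_B = {signed_perm s p | s p. (\<forall>i. s i \<in> {-1, 1}) \<and> p permutes UNIV}"

definition type_D :: "(real ^ 'n \<Rightarrow> real ^ 'n) set" where
  "type_D = {signed_perm s p | s p.
     (\<forall>i. s i \<in> {-1, 1}) \<and> even (card {i. s i = -1}) \<and> p permutes UNIV}"

definition hyperplane :: "'a::real_inner \<Rightarrow> 'a set" where
  "hyperplane a = {x. a \<bullet> x = 0}"

definition reflection :: "'a::real_inner \<Rightarrow> 'a \<Rightarrow> 'a" where
  "reflection a x = x - (2 * (a \<bullet> x) / (a \<bullet> a)) *\<^sub>R a"

definition reflection_arrangement :: "('a::real_inner \<Rightarrow> 'a) set \<Rightarrow> 'a set set" where
  "reflection_arrangement W = {hyperplane a | a. a \<noteq> 0 \<and> reflection a \<in> W}"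

definition fundamental_chamber :: "('a::real_inner \<Rightarrow> 'a) set \<Rightarrow> 'a set \<Rightarrow> bool" where
  "fundamental_chamber W C \<longleftrightarrow>
     (\<exists>R \<in> components (UNIV - \<Union> (reflection_arrangement W)). C = closure R)"

text \<open>The intersection of the empty subcollection is \<open>UNIV\<close>.\<close>

definition intersection_poset :: "'a set set \<Rightarrow> 'a set set" where
  "intersection_poset A = {\<Inter> B | B. B \<subseteq> A}"

text \<open>
  \<open>mu L\<close> is the Moebius function of \<open>L\<close>, ordered by reverse inclusion, based at the least
  element \<open>UNIV\<close>. It is defined by solving the equation that the values \<open>mu L z\<close>, with \<open>z \<in> L\<close>
  and \<open>y \<subseteq> z\<close>, sum to zero for the value at \<open>z = y\<close>. The value \<open>0\<close> for infinite \<open>L\<close> or for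
  \<open>y \<notin> L\<close> is a dummy.
\<close>

function mu :: "'a set set \<Rightarrow> 'a set \<Rightarrow> int" where
  "mu L y =
     (if \<not> finite L \<or> y \<notin> L then 0
      else if y = UNIV then 1
      else - (\<Sum>z \<in> {z \<in> L. y \<subset> z}. mu L z))"
  by auto
termination
proof (relation "Wellfounded.measure (\<lambda>(L, y). card {z \<in> L. y \<subset> z})")
  fix L :: "'a set set" and y z
  assume "\<not> (\<not> finite L \<or> y \<notin> L)" "z \<in> {z \<in> L. y \<subset> z}"
  then have "{w \<in> L. z \<subset> w} \<subset> {w \<in> L. y \<subset> w}" "finite {w \<in> L. y \<subset> w}"
    by auto
  then show "((L, z), (L, y)) \<in> Wellfounded.measure (\<lambda>(L, y). card {z \<in> L. y \<subset> z})"
    by (simp add: psubset_card_mono)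
qed simp

declare mu.simps [simp del]

definition characteristic_poly :: "'a::euclidean_space set set \<Rightarrow> int poly" where
  "characteristic_poly A =
     (\<Sum>y \<in> intersection_poset A. monom (mu (intersection_poset A) y) (dim y))"

lemma UNIV_in_intersection_poset: "UNIV \<in> intersection_poset A"
  unfolding intersection_poset_def by blast

lemma finite_intersection_poset:
  assumes "finite A"
  shows "finite (intersection_poset A)"
proof -
  have "intersection_poset A = \<Inter> ` Pow A"
    unfolding intersection_poset_def by blast
  with assms show ?thesis by simp
qed

lemma mu_UNIV:
  assumes "finite A"
  shows "mu (intersection_poset A) UNIV = 1"
  using assms
  by (subst mu.simps) (simp add: finite_intersection_poset UNIV_in_intersection_poset)

lemma sum_mu_eq_0:
  assumes "finite A" "y \<in> intersection_poset A" "y \<noteq> UNIV"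
  shows "(\<Sum>z \<in> {z \<in> intersection_poset A. y \<subseteq> z}. mu (intersection_poset A) z) = 0"
proof -
  let ?L = "intersection_poset A"
  have fin: "finite ?L" using assms(1) by (rule finite_intersection_poset)
  have "{z \<in> ?L. y \<subseteq> z} = insert y {z \<in> ?L. y \<subset> z}"
    using assms(2) by blast
  then have "(\<Sum>z \<in> {z \<in> ?L. y \<subseteq> z}. mu ?L z) = mu ?L y + (\<Sum>z \<in> {z \<in> ?L. y \<subset> z}. mu ?L z)"
    using fin by simp
  also have "mu ?L y = - (\<Sum>z \<in> {z \<in> ?L. y \<subset> z}. mu ?L z)"
    using assms fin by (subst mu.simps) simp
  finally show ?thesis by simp
qed

text \<open>
  The empty set also counts as a face for \<open>face_of\<close>; it is harmless here because its
  relative interior is empty.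
\<close>

definition projection_has_dim :: "'a::euclidean_space set \<Rightarrow> 'a \<Rightarrow> nat \<Rightarrow> bool" where
  "projection_has_dim C y k \<longleftrightarrow>
     (\<exists>F. F face_of C \<and> aff_dim F = int k \<and> closest_point C y \<in> rel_interior F)"

lemma axis_component: "axis i c $ k = (if k = i then c else 0)"
  by (simp add: axis_def)

lemma inner_axis_add:
  fixes x :: "real ^ 'n"
  shows "(axis i c + axis j d) \<bullet> x = c * x $ i + d * x $ j"
  by (simp add: inner_add_left inner_axis')

lemma reflection_eq_signed_perm_swap:
  fixes i j :: "'n::finite"
  assumes "i \<noteq> j" "c \<in> {-1, 1::real}"
  shows "reflection (axis i 1 + axis j (- c)) =
    signed_perm (\<lambda>k. if k = i \<or> k = j then c else 1) (Transposition.transpose i j)"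
proof
  fix x :: "real ^ 'n"
  let ?a = "axis i 1 + axis j (- c) :: real ^ 'n"
  have "?a \<bullet> ?a = 2"
    unfolding inner_axis_add using assms by (auto simp: axis_component)
  moreover have "?a \<bullet> x = x $ i - c * x $ j"
    unfolding inner_axis_add by simp
  ultimately have "reflection ?a x = x - (x $ i - c * x $ j) *\<^sub>R ?a"
    unfolding reflection_def by simp
  then show "reflection ?a x =
      signed_perm (\<lambda>k. if k = i \<or> k = j then c else 1) (Transposition.transpose i j) x"
    using assms
    by (auto simp: signed_perm_def vec_eq_iff axis_component Transposition.transpose_def)
qed

lemma reflection_eq_signed_perm_id:
  fixes i :: "'n::finite"
  shows "reflection (axis i 1) = signed_perm (\<lambda>k. if k = i then -1 else 1) id"
  by (rule ext)
    (auto simp: reflection_def signed_perm_def vec_eq_iff axis_component inner_axis' inner_axis)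

lemma reflection_eq_signed_permD:
  fixes a :: "real ^ 'n"
  assumes eq: "reflection a = signed_perm s p" and a: "a \<noteq> 0" and s: "\<And>i. s i \<in> {-1, 1}"
  obtains
    (swap) i j where "i \<noteq> j" "hyperplane a = {x. x $ i = s i * x $ j}"
  | (neg) i where "hyperplane a = {x. x $ i = 0}" "{i. s i = -1} = {i}"
proof -
  have pos: "a \<bullet> a > 0" using a by simp
  have ent: "(if k = i then 1 else 0) - 2 * a $ k * a $ i / (a \<bullet> a) =
      (if k = p i then s i else 0)" for i k
  proof -
    have "reflection a (axis k 1) $ i = signed_perm s p (axis k 1) $ i"
      using eq by simp
    then show ?thesis
      by (auto simp: reflection_def signed_perm_def axis_component inner_axis split: if_splits)
  qed
  obtain i where i: "a $ i \<noteq> 0" using a by (auto simp: vec_eq_iff)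
  have zero: "a $ k = 0" if "k \<noteq> i" "k \<noteq> p i" for k
    using ent[of k i] that i pos by simp
  show ?thesis
  proof (cases "p i = i")
    case True
    have ak: "a $ k = 0" if "k \<noteq> i" for k using zero that True by simp
    have a_eq: "a = axis i (a $ i)" using ak by (auto simp: vec_eq_iff axis_component)
    have inn: "a \<bullet> x = a $ i * x $ i" for x
      by (subst a_eq) (simp add: inner_axis')
    have "s i = -1" using ent[of i i] True i inn[of a] by (simp add: field_simps)
    moreover have "s m \<noteq> -1" if "m \<noteq> i" for m
      using ent[of m m] that ak[of m] by (auto split: if_splits)
    ultimately have "{i. s i = -1} = {i}" by auto
    then show ?thesis using neg[of i] i inn by (auto simp: hyperplane_def)
  next
    case False
    define j where "j = p i"
    have "i \<noteq> j" using False j_def by simp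
    have aa: "a \<bullet> a = 2 * a $ i * a $ i"
      using ent[of i i] False pos by (simp add: field_simps)
    have aj: "a $ j = - s i * a $ i"
      using ent[of j i] \<open>i \<noteq> j\<close> i unfolding aa j_def[symmetric] by (simp add: field_simps)
    have a_eq: "a = axis i (a $ i) + axis j (a $ j)"
      using zero \<open>i \<noteq> j\<close> by (auto simp: vec_eq_iff axis_component j_def)
    have inn: "a \<bullet> x = a $ i * x $ i + a $ j * x $ j" for x
      by (subst a_eq) (rule inner_axis_add)
    have "a \<bullet> x = a $ i * (x $ i - s i * x $ j)" for x
      using inn[of x] by (simp add: aj algebra_simps)
    then have "hyperplane a = {x. x $ i = s i * x $ j}"
      using i by (simp add: hyperplane_def)
    then show ?thesis using swap \<open>i \<noteq> j\<close> by blast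
  qed
qed

lemma mirror_swap:
  fixes i j :: "'n::finite"
  assumes "i \<noteq> j" "c \<in> {-1, 1::real}"
    and "signed_perm (\<lambda>k. if k = i \<or> k = j then c else 1) (Transposition.transpose i j) \<in> W"
  shows "{x :: real ^ 'n. x $ i = c * x $ j} \<in> reflection_arrangement W"
proof -
  let ?a = "axis i 1 + axis j (- c) :: real ^ 'n"
  have "?a $ i = 1" using assms(1) by (simp add: axis_component)
  then have "?a \<noteq> 0" by (intro notI) simp
  moreover have "hyperplane ?a = {x. x $ i = c * x $ j}"
    unfolding hyperplane_def inner_axis_add by simp
  moreover have "reflection ?a \<in> W"
    unfolding reflection_eq_signed_perm_swap[OF assms(1,2)] by (fact assms(3))
  ultimately show ?thesis
    unfolding reflection_arrangement_def by blast
qed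

theorem reflection_arrangement_A:
  "reflection_arrangement (type_A :: (real ^ 'n \<Rightarrow> real ^ 'n) set) =
     {{x. x $ i = x $ j} | i j. i \<noteq> j}" (is "?L = ?R")
proof
  show "?L \<subseteq> ?R"
  proof
    fix H assume "H \<in> ?L"
    then obtain a p where *: "H = hyperplane a" "a \<noteq> 0" "reflection a = signed_perm (\<lambda>_. 1) p"
      by (auto simp: reflection_arrangement_def type_A_def)
    have "(\<lambda>_. 1) i \<in> {-1, 1 :: real}" for i :: 'n by simp
    from *(3,2) this show "H \<in> ?R"
    proof (cases rule: reflection_eq_signed_permD)
      case (swap i j)
      then have "H = {x. x $ i = x $ j}" using * by simp
      then show ?thesis using swap(1) by blast
    qed auto
  qed
  show "?R \<subseteq> ?L"
  proof
    fix H assume "H \<in> ?R"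
    then obtain i j where ij: "i \<noteq> j" "H = {x. x $ i = 1 * x $ j}" by auto
    have "Transposition.transpose i j permutes UNIV"
      by (rule permutes_swap_id) simp_all
    then have "signed_perm (\<lambda>k. if k = i \<or> k = j then 1 else 1) (Transposition.transpose i j) \<in> type_A"
      unfolding type_A_def if_cancel by blast
    then show "H \<in> ?L" unfolding ij(2) using mirror_swap[OF ij(1), of 1] by blast
  qed
qed

theorem reflection_arrangement_B:
  "reflection_arrangement (type_B :: (real ^ 'n \<Rightarrow> real ^ 'n) set) =
     {{x. x $ i = x $ j} | i j. i \<noteq> j} \<union> {{x. x $ i = - x $ j} | i j. i \<noteq> j} \<union>
     {{x. x $ k = 0} | k. True}" (is "?L = ?R1 \<union> ?R2 \<union> ?R3")
proof
  show "?L \<subseteq> ?R1 \<union> ?R2 \<union> ?R3"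
  proof
    fix H assume "H \<in> ?L"
    then obtain a where a: "H = hyperplane a" "a \<noteq> 0" "reflection a \<in> type_B"
      unfolding reflection_arrangement_def by blast
    then obtain s p where sp: "reflection a = signed_perm s p" "\<forall>i. s i \<in> {-1, 1}"
      unfolding type_B_def by blast
    have s: "s i \<in> {-1, 1}" for i using sp(2) by (rule spec)
    from sp(1) a(2) s show "H \<in> ?R1 \<union> ?R2 \<union> ?R3"
    proof (cases rule: reflection_eq_signed_permD)
      case (swap i j)
      have "s i = -1 \<or> s i = 1" using s[of i] by simp
      then have "H = {x. x $ i = - x $ j} \<or> H = {x. x $ i = x $ j}"
      proof (rule disj_forward)
        assume "s i = -1"
        show "H = {x. x $ i = - x $ j}"
          unfolding a(1) swap(2) \<open>s i = -1\<close> by simp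
      next
        assume "s i = 1"
        show "H = {x. x $ i = x $ j}"
          unfolding a(1) swap(2) \<open>s i = 1\<close> by simp
      qed
      then show ?thesis using swap(1) by blast
    next
      case (neg i)
      then show ?thesis using a(1) by blast
    qed
  qed
  have "?R3 \<subseteq> ?L"
  proof
    fix H assume "H \<in> ?R3"
    then obtain k where k: "H = {x. x $ k = 0}" by blast
    have "\<forall>i. (if i = k then -1 else 1) \<in> {-1, 1 :: real}" by simp
    then have "reflection (axis k 1) \<in> (type_B :: (real ^ 'n \<Rightarrow> real ^ 'n) set)"
      unfolding reflection_eq_signed_perm_id type_B_def using permutes_id[of UNIV] by blast
    moreover have "hyperplane (axis k 1) = H"
      unfolding k hyperplane_def by (simp add: inner_axis')
    moreover have "axis k 1 \<noteq> (0 :: real ^ 'n)" by (simp add: axis_eq_0_iff)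
    ultimately show "H \<in> ?L" unfolding reflection_arrangement_def by blast
  qed
  moreover have "{x. x $ i = c * x $ j} \<in> ?L" if ij: "i \<noteq> j" "c \<in> {-1, 1}" for i j c
  proof (rule mirror_swap[OF that])
    let ?s = "\<lambda>k. if k = i \<or> k = j then c else 1"
    have "\<forall>k. ?s k \<in> {-1, 1}" using ij by simp
    then show "signed_perm ?s (Transposition.transpose i j) \<in> type_B"
      unfolding type_B_def using permutes_swap_id[of i UNIV j] by blast
  qed
  from this[of _ _ 1] this[of _ _ "-1"] have "?R1 \<subseteq> ?L" "?R2 \<subseteq> ?L" by auto
  ultimately show "?R1 \<union> ?R2 \<union> ?R3 \<subseteq> ?L" by blast
qed

theorem reflection_arrangement_D:
  "reflection_arrangement (type_D :: (real ^ 'n \<Rightarrow> real ^ 'n) set) =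
     {{x. x $ i = x $ j} | i j. i \<noteq> j} \<union> {{x. x $ i = - x $ j} | i j. i \<noteq> j}"
  (is "?L = ?R1 \<union> ?R2")
proof
  show "?L \<subseteq> ?R1 \<union> ?R2"
  proof
    fix H assume "H \<in> ?L"
    then obtain a where a: "H = hyperplane a" "a \<noteq> 0" "reflection a \<in> type_D"
      unfolding reflection_arrangement_def by blast
    then obtain s p where sp: "reflection a = signed_perm s p" "\<forall>i. s i \<in> {-1, 1}"
        "even (card {i. s i = -1})"
      unfolding type_D_def by blast
    have s: "s i \<in> {-1, 1}" for i using sp(2) by (rule spec)
    from sp(1) a(2) s show "H \<in> ?R1 \<union> ?R2"
    proof (cases rule: reflection_eq_signed_permD)
      case (swap i j)
      have "s i = -1 \<or> s i = 1" using s[of i] by simp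
      then have "H = {x. x $ i = - x $ j} \<or> H = {x. x $ i = x $ j}"
      proof (rule disj_forward)
        assume "s i = -1"
        show "H = {x. x $ i = - x $ j}"
          unfolding a(1) swap(2) \<open>s i = -1\<close> by simp
      next
        assume "s i = 1"
        show "H = {x. x $ i = x $ j}"
          unfolding a(1) swap(2) \<open>s i = 1\<close> by simp
      qed
      then show ?thesis using swap(1) by blast
    next
      case (neg i)
      then show ?thesis using sp(3) by simp
    qed
  qed
  have "{x. x $ i = c * x $ j} \<in> ?L" if ij: "i \<noteq> j" "c \<in> {-1, 1}" for i j c
  proof (rule mirror_swap[OF that])
    let ?s = "\<lambda>k. if k = i \<or> k = j then c else 1"
    have "{k. ?s k = -1} = (if c = -1 then {i, j} else {})" using ij by auto
    then have "even (card {k. ?s k = -1})" using ij by simp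
    moreover have "\<forall>k. ?s k \<in> {-1, 1}" using ij by simp
    ultimately show "signed_perm ?s (Transposition.transpose i j) \<in> type_D"
      unfolding type_D_def using permutes_swap_id[of i UNIV j] by blast
  qed
  from this[of _ _ 1] this[of _ _ "-1"] show "?R1 \<union> ?R2 \<subseteq> ?L" by auto
qed

end

theory Submission
  imports Defs
begin

text \<open>
  For a fixed generic \<open>x\<close>, count the chambers \<open>D\<close> of an arrangement by the dimension of the face
  of \<open>D\<close> whose relative interior contains the point of \<open>D\<close> nearest to \<open>x\<close>. These numbers satisfy the
  deletion-restriction recursion of
  the characteristic polynomial up to signs: if a new hyperplane \<open>H\<close> cuts the chamber \<open>D\<close>, then
  the nearest point of one half of \<open>D\<close> is that of \<open>D\<close>, and the nearest point of the other half is
  that of the wall \<open>D \<inter> H\<close>, a chamber of the restriction. Hence the chambers whose nearest point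
  lies in a \<open>k\<close>-dimensional face are counted by the absolute value of the coefficient of \<open>t\<^sup>k\<close>.
  As \<open>W\<close> acts simply transitively on the chambers by isometries, projecting \<open>g x\<close> onto the chamber
  \<open>C\<close> amounts to projecting \<open>x\<close> onto the chamber \<open>g\<^sup>-\<^sup>1 C\<close>.
\<close>

section \<open>Chambers and deletion-restriction\<close>

text \<open>The ambient subspace \<open>V\<close> is a parameter so that restriction to the mirror
  of \<open>a\<close> only replaces \<open>V\<close> by \<open>V \<inter> hyperplane a\<close>. The
  normals stay the same vectors, and several of them may then cut out the same mirror of the
  restriction.\<close>

definition flat :: "'a::real_inner set \<Rightarrow> 'a set \<Rightarrow> 'a set" where
  "flat V B = {v \<in> V. \<forall>b\<in>B. b \<bullet> v = 0}"

text \<open>A sign vector on \<open>S\<close> is encoded by the set \<open>T\<close> of its positive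
  entries; for \<open>T \<subseteq> S\<close> the nonempty cells are the chambers of the arrangement
  in \<open>V\<close>.\<close>

definition open_cell :: "'a::real_inner set \<Rightarrow> 'a set \<Rightarrow> 'a set \<Rightarrow> 'a set" where
  "open_cell V S T = {v \<in> V. (\<forall>a\<in>T. a \<bullet> v > 0) \<and> (\<forall>a\<in>S - T. a \<bullet> v < 0)}"

definition closed_cell :: "'a::real_inner set \<Rightarrow> 'a set \<Rightarrow> 'a set \<Rightarrow> 'a set" where
  "closed_cell V S T = {v \<in> V. (\<forall>a\<in>T. a \<bullet> v \<ge> 0) \<and> (\<forall>a\<in>S - T. a \<bullet> v \<le> 0)}"

text \<open>Whitney's subset expansion of the characteristic polynomial. Summing over sets of
  normals rather than of mirrors keeps it meaningful when a restriction makes mirrors coincide or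
  contain \<open>V\<close>; in the latter case it vanishes.\<close>

definition whitney :: "'a::euclidean_space set \<Rightarrow> 'a set \<Rightarrow> int poly" where
  "whitney V S = (\<Sum>B\<in>Pow S. monom ((-1) ^ card B) (dim (flat V B)))"

text \<open>For \<open>p \<in> V\<close>, the dimension of the smallest flat through
  \<open>p\<close>. For a point of a chamber this is the dimension of the face that has it in its
  relative interior.\<close>

definition flat_dim :: "'a::euclidean_space set \<Rightarrow> 'a set \<Rightarrow> 'a \<Rightarrow> nat" where
  "flat_dim V S p = dim (flat V {a\<in>S. a \<bullet> p = 0})"

text \<open>Here \<open>p\<close> is the orthogonal projection of \<open>x\<close> onto a flat: it
  may lie on a mirror only if the whole flat does.\<close>

definition generic :: "'a::real_inner set \<Rightarrow> 'a set \<Rightarrow> 'a \<Rightarrow> bool" where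
  "generic V S x \<longleftrightarrow> (\<forall>B\<subseteq>S. \<forall>a\<in>S. \<forall>p\<in>flat V B.
     (\<forall>v\<in>flat V B. (x - p) \<bullet> v = 0) \<longrightarrow> a \<bullet> p = 0 \<longrightarrow> flat V B \<subseteq> hyperplane a)"

lemma flat_empty [simp]: "flat V {} = V"
  by (auto simp: flat_def)

lemma flat_insert: "flat V (insert a B) = flat (V \<inter> hyperplane a) B"
  by (auto simp: flat_def hyperplane_def)

lemma subspace_mirror: "subspace (hyperplane a)"
  by (simp add: hyperplane_def subspace_hyperplane)

lemma subspace_flat: "subspace V \<Longrightarrow> subspace (flat V B)"
  unfolding flat_def subspace_def by (auto simp: inner_right_distrib)

text \<open>Deletion-restriction: the subsets containing \<open>a\<close> yield the flats of the
  restriction, with one more element and hence the opposite sign.\<close>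

lemma whitney_insert:
  assumes "finite S" "a \<notin> S"
  shows "whitney V (insert a S) = whitney V S - whitney (V \<inter> hyperplane a) S"
proof -
  let ?m = "\<lambda>V B. monom ((-1) ^ card B) (dim (flat V B)) :: int poly"
  have inj: "inj_on (insert a) (Pow S)" using assms by (auto simp: inj_on_def)
  have "whitney V (insert a S) = whitney V S + (\<Sum>B\<in>insert a ` Pow S. ?m V B)"
    unfolding whitney_def Pow_insert using assms
    by (intro sum.union_disjoint) auto
  also have "(\<Sum>B\<in>insert a ` Pow S. ?m V B) = (\<Sum>B\<in>Pow S. ?m V (insert a B))"
    by (simp add: sum.reindex[OF inj])
  also have "\<dots> = (\<Sum>B\<in>Pow S. - ?m (V \<inter> hyperplane a) B)"
  proof (rule sum.cong[OF refl])
    fix B assume "B \<in> Pow S"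
    then have "finite B" "a \<notin> B" using assms finite_subset by auto
    then show "?m V (insert a B) = - ?m (V \<inter> hyperplane a) B"
      by (simp add: flat_insert minus_monom)
  qed
  finally show ?thesis by (simp add: whitney_def sum_negf)
qed

lemma dim_Int_hyperplane:
  fixes V :: "'a::euclidean_space set"
  assumes V: "subspace V" and "\<not> V \<subseteq> hyperplane a"
  shows "dim V = Suc (dim (V \<inter> hyperplane a))"
proof -
  obtain w where w: "w \<in> V" "a \<bullet> w \<noteq> 0" using assms by (auto simp: hyperplane_def)
  then have "a \<noteq> 0" by auto
  have "{x + y |x y. x \<in> V \<and> y \<in> hyperplane a} = UNIV"
  proof -
    have "\<exists>x y. z = x + y \<and> x \<in> V \<and> y \<in> hyperplane a" for z
    proof (intro exI conjI)
      \<comment> \<open>The multiple of \<open>w\<close> has the same inner product with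
        \<open>a\<close> as \<open>z\<close>, so the remainder lies in the hyperplane.\<close>
      show "z = (a \<bullet> z / (a \<bullet> w)) *\<^sub>R w + (z - (a \<bullet> z / (a \<bullet> w)) *\<^sub>R w)" by simp
      show "(a \<bullet> z / (a \<bullet> w)) *\<^sub>R w \<in> V" using V w by (simp add: subspace_scale)
      show "z - (a \<bullet> z / (a \<bullet> w)) *\<^sub>R w \<in> hyperplane a"
        using w by (simp add: hyperplane_def inner_diff_right)
    qed
    then show ?thesis by auto
  qed
  then have "DIM('a) + dim (V \<inter> hyperplane a) = dim V + dim (hyperplane a)"
    using dim_sums_Int[OF V subspace_mirror, of a] by simp
  moreover have "dim (hyperplane a) = DIM('a) - 1"
    unfolding hyperplane_def using \<open>a \<noteq> 0\<close> by (rule dim_hyperplane)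
  ultimately show ?thesis using DIM_positive[where 'a='a] by linarith
qed

section \<open>Nearest points of convex sets and of cells\<close>

lemma inner_self_le_0D: "x \<bullet> x \<le> 0 \<Longrightarrow> x = 0"
  using inner_eq_zero_iff[of x] inner_ge_zero[of x] by linarith

text \<open>The obtuse-angle inequality characterises the nearest point: adding it for
  \<open>p\<close> and for \<open>?q\<close> bounds their squared distance by 0.\<close>

lemma closest_point_eqI:
  fixes K :: "'a::euclidean_space set"
  assumes "closed K" "convex K" "p \<in> K" "\<And>y. y \<in> K \<Longrightarrow> (x - p) \<bullet> (y - p) \<le> 0"
  shows "closest_point K x = p"
proof -
  let ?q = "closest_point K x"
  have "?q \<in> K" using assms closest_point_in_set by blast
  then have "(x - p) \<bullet> (?q - p) \<le> 0" by (rule assms(4))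
  moreover have "(x - ?q) \<bullet> (p - ?q) \<le> 0"
    using assms by (intro closest_point_dot) auto
  ultimately have "(p - ?q) \<bullet> (p - ?q) \<le> 0"
    by (simp add: inner_diff_left inner_diff_right inner_commute)
  then have "p - ?q = 0" by (rule inner_self_le_0D)
  then show ?thesis by simp
qed

lemma closest_point_subset:
  fixes K :: "'a::euclidean_space set"
  assumes "closed K" "convex K" "closed J" "convex J" "J \<subseteq> K" "closest_point K x \<in> J"
  shows "closest_point J x = closest_point K x"
  using assms by (intro closest_point_eqI closest_point_dot) auto

text \<open>If the nearest point of the other half were off the dividing hyperplane, moving from it
  towards \<open>closest_point K x\<close> would stay in that half and decrease the distance to \<open>x\<close>.\<close>

lemma closest_point_halfspace:
  fixes K :: "'a::euclidean_space set"
  assumes K: "closed K" "convex K" and ne: "K \<inter> {v. a \<bullet> v \<le> 0} \<noteq> {}"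
    and pos: "a \<bullet> closest_point K x > 0"
  shows "a \<bullet> closest_point (K \<inter> {v. a \<bullet> v \<le> 0}) x = 0"
proof (rule ccontr)
  let ?J = "K \<inter> {v. a \<bullet> v \<le> 0}"
  let ?p = "closest_point K x" and ?q = "closest_point ?J x"
  assume nz: "a \<bullet> ?q \<noteq> 0"
  have J: "closed ?J" "convex ?J"
    using K by (auto intro: closed_Int convex_Int simp: closed_halfspace_le convex_halfspace_le)
  have q: "?q \<in> ?J" using J ne closest_point_in_set by blast
  have p: "?p \<in> K" using K ne closest_point_in_set by blast
  have neg: "a \<bullet> ?q < 0" using q nz by auto
  define t where "t = - (a \<bullet> ?q) / (a \<bullet> ?p - a \<bullet> ?q)"
  have t: "t > 0" "t \<le> 1" unfolding t_def using neg pos by (auto simp: field_simps)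
  let ?m = "(1 - t) *\<^sub>R ?q + t *\<^sub>R ?p"
  have "?m \<in> K" using K(2) p q t by (intro convexD_alt) auto
  moreover have "a \<bullet> ?m = a \<bullet> ?q + t * (a \<bullet> ?p - a \<bullet> ?q)"
    by (simp add: inner_add_right algebra_simps)
  then have "a \<bullet> ?m = 0" unfolding t_def using neg pos by simp
  ultimately have "?m \<in> ?J" by simp
  with J have "(x - ?q) \<bullet> (?m - ?q) \<le> 0" by (intro closest_point_dot) auto
  also have "?m - ?q = t *\<^sub>R (?p - ?q)" by (simp add: algebra_simps)
  finally have "(x - ?q) \<bullet> (?p - ?q) \<le> 0" using t by (simp add: mult_le_0_iff)
  moreover have "(x - ?p) \<bullet> (?q - ?p) \<le> 0"
    using K q by (intro closest_point_dot) auto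
  ultimately have "(?p - ?q) \<bullet> (?p - ?q) \<le> 0"
    by (simp add: inner_diff_left inner_diff_right inner_commute)
  then have "?p - ?q = 0" by (rule inner_self_le_0D)
  then show False using pos neg by simp
qed

lemma closed_cell_eq:
  "closed_cell V S T = V \<inter> (\<Inter>a\<in>T. {v. a \<bullet> v \<ge> 0}) \<inter> (\<Inter>a\<in>S - T. {v. a \<bullet> v \<le> 0})"
  by (auto simp: closed_cell_def)

lemma convex_closed_cell: "subspace V \<Longrightarrow> convex (closed_cell V S T)"
  unfolding closed_cell_eq
  by (intro convex_Int convex_INT) (auto simp: subspace_imp_convex convex_halfspace_ge convex_halfspace_le)

lemma closed_closed_cell:
  fixes V :: "'a::euclidean_space set"
  shows "subspace V \<Longrightarrow> closed (closed_cell V S T)"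
  unfolding closed_cell_eq
  by (intro closed_Int closed_INT) (auto simp: closed_subspace closed_halfspace_ge closed_halfspace_le)

lemma zero_in_closed_cell: "subspace V \<Longrightarrow> 0 \<in> closed_cell V S T"
  by (simp add: closed_cell_def subspace_0)

lemma closest_point_in_closed_cell:
  fixes V :: "'a::euclidean_space set"
  shows "subspace V \<Longrightarrow> closest_point (closed_cell V S T) x \<in> closed_cell V S T"
  using closed_closed_cell zero_in_closed_cell closest_point_in_set by blast

text \<open>A weak inequality plus a strict one of the same sign is strict.\<close>

lemma open_cell_add:
  assumes "subspace V" "u \<in> closed_cell V S T" "r \<in> open_cell V S T" "e > 0"
  shows "u + e *\<^sub>R r \<in> open_cell V S T"
  using assms unfolding open_cell_def closed_cell_def
  by (auto simp: subspace_add subspace_scale inner_add_right add_nonneg_pos add_nonpos_neg mult_pos_neg)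

text \<open>Provides a step length for moving from \<open>p\<close> along \<open>v\<close> in either
  direction without changing the sign of any nonzero \<open>b \<bullet> p\<close>.\<close>

lemma finite_small_multiple:
  assumes "finite S"
  obtains e :: real where "e > 0" "\<And>b. b \<in> S \<Longrightarrow> b \<bullet> p \<noteq> 0 \<Longrightarrow> e * \<bar>b \<bullet> v\<bar> < \<bar>b \<bullet> p\<bar>"
proof -
  have "\<exists>e>0. \<forall>b\<in>S. b \<bullet> p \<noteq> 0 \<longrightarrow> e * \<bar>b \<bullet> v\<bar> < \<bar>b \<bullet> p\<bar>"
    using assms
  proof (induction S)
    case empty
    show ?case by (intro exI[of _ 1]) simp
  next
    case (insert c S)
    then obtain e where e: "e > 0" "\<forall>b\<in>S. b \<bullet> p \<noteq> 0 \<longrightarrow> e * \<bar>b \<bullet> v\<bar> < \<bar>b \<bullet> p\<bar>" by blast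
    show ?case
    proof (cases "c \<bullet> p = 0")
      case True
      then show ?thesis using e by blast
    next
      case False
      \<comment> \<open>The summand 1 avoids a division by zero and makes the final inequality
        strict.\<close>
      define d where "d = min e (\<bar>c \<bullet> p\<bar> / (\<bar>c \<bullet> v\<bar> + 1))"
      have d: "d > 0" "d \<le> e" "d \<le> \<bar>c \<bullet> p\<bar> / (\<bar>c \<bullet> v\<bar> + 1)"
        using e False by (auto simp: d_def)
      have "d * (\<bar>c \<bullet> v\<bar> + 1) \<le> \<bar>c \<bullet> p\<bar>" using d(3) by (simp add: field_simps)
      then have "d * \<bar>c \<bullet> v\<bar> < \<bar>c \<bullet> p\<bar>" using d(1) by (simp add: algebra_simps)
      moreover have "d * \<bar>b \<bullet> v\<bar> < \<bar>b \<bullet> p\<bar>" if "b \<in> S" "b \<bullet> p \<noteq> 0" for b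
        using mult_right_mono[OF d(2), of "\<bar>b \<bullet> v\<bar>"] e(2)[rule_format, OF that] by linarith
      ultimately show ?thesis using d(1) by blast
    qed
  qed
  then show ?thesis using that by blast
qed

text \<open>In each direction \<open>v\<close> of the smallest flat through \<open>p\<close> the
  cell contains a short segment around \<open>p\<close>, so the obtuse-angle inequality holds for
  \<open>v\<close> and \<open>- v\<close>. Hence \<open>p\<close> is the projection of
  \<open>x\<close> onto that flat, the situation that \<open>generic\<close> speaks about.\<close>

lemma closest_point_orthogonal_flat:
  fixes V :: "'a::euclidean_space set"
  assumes "finite S" and V: "subspace V"
    and p: "p = closest_point (closed_cell V S T) x"
    and v: "v \<in> flat V {a\<in>S. a \<bullet> p = 0}" and T: "T \<subseteq> S"
  shows "(x - p) \<bullet> v = 0"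
proof -
  have pc: "p \<in> closed_cell V S T" unfolding p using V by (rule closest_point_in_closed_cell)
  obtain e where e: "e > 0" "\<And>b. b \<in> S \<Longrightarrow> b \<bullet> p \<noteq> 0 \<Longrightarrow> e * \<bar>b \<bullet> v\<bar> < \<bar>b \<bullet> p\<bar>"
    using finite_small_multiple[OF assms(1)] by blast
  have "p + d *\<^sub>R v \<in> closed_cell V S T" if d: "\<bar>d\<bar> = e" for d
  proof -
    have small: "\<bar>d * (b \<bullet> v)\<bar> \<le> \<bar>b \<bullet> p\<bar>" if "b \<in> S" for b
    proof (cases "b \<bullet> p = 0")
      case True
      then show ?thesis using v that by (simp add: flat_def)
    next
      case False
      then show ?thesis using e(2)[OF that False] d by (simp add: abs_mult)
    qed
    have "0 \<le> b \<bullet> p + d * (b \<bullet> v)" if "b \<in> T" for b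
    proof -
      have "b \<bullet> p \<ge> 0" "b \<in> S" using pc that T by (auto simp: closed_cell_def)
      then show ?thesis using small[of b] by linarith
    qed
    moreover have "b \<bullet> p + d * (b \<bullet> v) \<le> 0" if "b \<in> S - T" for b
    proof -
      have "b \<bullet> p \<le> 0" "b \<in> S" using pc that by (auto simp: closed_cell_def)
      then show ?thesis using small[of b] by linarith
    qed
    moreover have "p + d *\<^sub>R v \<in> V"
      using V pc v by (auto simp: closed_cell_def flat_def subspace_add subspace_scale)
    ultimately show ?thesis by (auto simp: closed_cell_def inner_add_right)
  qed
  then have "(x - p) \<bullet> ((p + d *\<^sub>R v) - p) \<le> 0" if "\<bar>d\<bar> = e" for d
    unfolding p using that V
    by (intro closest_point_dot) (auto simp: convex_closed_cell closed_closed_cell p)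
  from this[of e] this[of "-e"] have "e * ((x - p) \<bullet> v) \<le> 0" "- e * ((x - p) \<bullet> v) \<le> 0"
    using e(1) by simp_all
  then show ?thesis using e(1) by (simp add: mult_le_0_iff zero_le_mult_iff)
qed

section \<open>Cutting a cell by a new mirror\<close>

lemma open_cell_insert:
  assumes "a \<notin> S" "T \<subseteq> S"
  shows "open_cell V (insert a S) (insert a T) = open_cell V S T \<inter> {v. a \<bullet> v > 0}"
    and "open_cell V (insert a S) T = open_cell V S T \<inter> {v. a \<bullet> v < 0}"
    and "open_cell (V \<inter> hyperplane a) S T = open_cell V S T \<inter> {v. a \<bullet> v = 0}"
  using assms by (auto simp: open_cell_def hyperplane_def)

lemma closed_cell_insert:
  assumes "a \<notin> S" "T \<subseteq> S"
  shows "closed_cell V (insert a S) (insert a T) = closed_cell V S T \<inter> {v. a \<bullet> v \<ge> 0}"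
    and "closed_cell V (insert a S) T = closed_cell V S T \<inter> {v. a \<bullet> v \<le> 0}"
    and "closed_cell (V \<inter> hyperplane a) S T = closed_cell V S T \<inter> {v. a \<bullet> v = 0}"
  using assms by (auto simp: closed_cell_def hyperplane_def)

lemma flat_dim_insert_nonzero:
  assumes "a \<bullet> p \<noteq> 0"
  shows "flat_dim V (insert a S) p = flat_dim V S p"
proof -
  have "{b \<in> insert a S. b \<bullet> p = 0} = {b \<in> S. b \<bullet> p = 0}" using assms by auto
  then show ?thesis by (simp add: flat_dim_def)
qed

lemma flat_dim_insert_zero:
  assumes "a \<bullet> p = 0"
  shows "flat_dim V (insert a S) p = flat_dim (V \<inter> hyperplane a) S p"
proof -
  have "{b \<in> insert a S. b \<bullet> p = 0} = insert a {b \<in> S. b \<bullet> p = 0}" using assms by auto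
  then show ?thesis by (simp add: flat_dim_def flat_insert)
qed

text \<open>By orthogonality \<open>p\<close> is the projection of \<open>x\<close> onto its
  smallest flat. If the new mirror contains \<open>p\<close>, genericity makes it contain that flat,
  so intersecting with it changes nothing.\<close>

lemma flat_dim_closest_point_insert:
  fixes V :: "'a::euclidean_space set"
  assumes "finite S" "subspace V" "T \<subseteq> S" and gen: "generic V (insert a S) x"
    and p: "p = closest_point (closed_cell V S T) x"
  shows "flat_dim V (insert a S) p = flat_dim V S p"
proof (cases "a \<bullet> p = 0")
  case True
  let ?B = "{b \<in> S. b \<bullet> p = 0}"
  have "p \<in> V" using closest_point_in_closed_cell[OF assms(2)] p by (auto simp: closed_cell_def)
  then have "p \<in> flat V ?B" by (auto simp: flat_def)
  moreover have "\<forall>v\<in>flat V ?B. (x - p) \<bullet> v = 0"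
    by (intro ballI closest_point_orthogonal_flat[OF assms(1,2) p _ assms(3)])
  ultimately have "flat V ?B \<subseteq> hyperplane a"
    using gen[unfolded generic_def, rule_format, of ?B a p] True by (simp add: subset_insertI2)
  then have "flat (V \<inter> hyperplane a) ?B = flat V ?B" by (auto simp: flat_def)
  then show ?thesis using flat_dim_insert_zero[OF True] by (simp add: flat_dim_def)
qed (rule flat_dim_insert_nonzero)

text \<open>A 0/1 indicator, so that sums over \<open>Pow S\<close> count chambers. The nonemptiness
  test matters because, for a subspace \<open>V\<close>, the closed cell contains 0 and has a
  nearest point even where the open cell is empty.\<close>

definition cell_count :: "nat \<Rightarrow> 'a::euclidean_space \<Rightarrow> 'a set \<Rightarrow> 'a set \<Rightarrow> 'a set \<Rightarrow> nat" where
  "cell_count k x V S T = of_bool (open_cell V S T \<noteq> {} \<and>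
     flat_dim V S (closest_point (closed_cell V S T) x) = k)"

text \<open>Deletion-restriction for the counts, one sign vector at a time. A mirror that misses a
  nonempty open cell leaves it on one side, so one term on each side of the equation survives; a
  mirror that meets it produces two halves and a wall.\<close>

lemma cell_count_cut:
  fixes V :: "'a::euclidean_space set"
  assumes S: "finite S" "a \<notin> S" and V: "subspace V" "\<not> V \<subseteq> hyperplane a" and T: "T \<subseteq> S"
    and gen: "generic V (insert a S) x"
  shows "cell_count k x V (insert a S) (insert a T) + cell_count k x V (insert a S) T =
    cell_count k x V S T + cell_count k x (V \<inter> hyperplane a) S T"
proof -
  let ?R = "open_cell V S T" and ?K = "closed_cell V S T"
  let ?P = "?K \<inter> {v. a \<bullet> v \<ge> 0}" and ?N = "?K \<inter> {v. a \<bullet> v \<le> 0}" and ?Z = "?K \<inter> {v. a \<bullet> v = 0}"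
  let ?p = "\<lambda>J. closest_point J x"
  note oc = open_cell_insert[OF S(2) T, of V] and cc = closed_cell_insert[OF S(2) T, of V]
  have K: "closed ?K" "convex ?K" using V(1) by (simp_all add: closed_closed_cell convex_closed_cell)
  have cl: "closed ?P" "closed ?N" "closed ?Z" "convex ?P" "convex ?N" "convex ?Z"
    using K by (auto intro: closed_Int convex_Int simp: closed_halfspace_le convex_halfspace_le
        closed_halfspace_ge convex_halfspace_ge closed_hyperplane convex_hyperplane)
  have z0: "0 \<in> ?K" using V(1) by (rule zero_in_closed_cell)
  have "0 \<in> ?P" "0 \<in> ?N" "0 \<in> ?Z" using z0 by simp_all
  then have nes: "?K \<noteq> {}" "?P \<noteq> {}" "?N \<noteq> {}" "?Z \<noteq> {}" by blast+
  have mem: "?p ?K \<in> ?K" "?p ?P \<in> ?P" "?p ?N \<in> ?N"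
    using closest_point_in_set[OF K(1) nes(1)] closest_point_in_set[OF cl(1) nes(2)]
      closest_point_in_set[OF cl(2) nes(3)] by this
  have dK: "flat_dim V (insert a S) (?p ?K) = flat_dim V S (?p ?K)"
    using flat_dim_closest_point_insert[OF S(1) V(1) T gen] by blast
  consider "?R = {}" | "?R \<inter> {v. a \<bullet> v = 0} \<noteq> {}" | "?R \<noteq> {}" "?R \<inter> {v. a \<bullet> v = 0} = {}" by blast
  then show ?thesis
  proof cases
    case 1
    then show ?thesis by (simp add: cell_count_def oc)
  next
    case 2
    \<comment> \<open>A point of the cell on the mirror can be moved along \<open>w\<close> to both
      sides of the mirror within the cell, so both halves are nonempty.\<close>
    then obtain r where r: "r \<in> ?R" "a \<bullet> r = 0" by blast
    obtain w where w: "w \<in> V" "a \<bullet> w \<noteq> 0" using V by (auto simp: hyperplane_def)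
    obtain e where e: "e > 0" "\<And>b. b \<in> S \<Longrightarrow> b \<bullet> r \<noteq> 0 \<Longrightarrow> e * \<bar>b \<bullet> w\<bar> < \<bar>b \<bullet> r\<bar>"
      using finite_small_multiple[OF S(1)] by blast
    have near: "r + d *\<^sub>R w \<in> ?R" if d: "\<bar>d\<bar> = e" for d
    proof -
      have small: "\<bar>d * (b \<bullet> w)\<bar> < \<bar>b \<bullet> r\<bar>" if "b \<in> S" for b
      proof -
        have "b \<bullet> r \<noteq> 0" using r(1) that by (force simp: open_cell_def)
        then show ?thesis using e(2)[OF that] d by (simp add: abs_mult)
      qed
      have "0 < b \<bullet> r + d * (b \<bullet> w)" if "b \<in> T" for b
      proof -
        have "b \<bullet> r > 0" "b \<in> S" using r(1) that T by (auto simp: open_cell_def)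
        then show ?thesis using small[of b] by linarith
      qed
      moreover have "b \<bullet> r + d * (b \<bullet> w) < 0" if "b \<in> S - T" for b
      proof -
        have "b \<bullet> r < 0" "b \<in> S" using r(1) that by (auto simp: open_cell_def)
        then show ?thesis using small[of b] by linarith
      qed
      moreover have "r + d *\<^sub>R w \<in> V"
        using V(1) r(1) w by (auto simp: open_cell_def subspace_add subspace_scale)
      ultimately show ?thesis by (auto simp: open_cell_def inner_add_right)
    qed
    define d where "d = (if a \<bullet> w > 0 then e else - e)"
    have "\<bar>d\<bar> = e" "\<bar>- d\<bar> = e" "d * (a \<bullet> w) > 0"
      using e(1) w(2) by (auto simp: d_def mult_less_0_iff)
    then have "r + d *\<^sub>R w \<in> ?R \<inter> {v. a \<bullet> v > 0}" "r + (- d) *\<^sub>R w \<in> ?R \<inter> {v. a \<bullet> v < 0}"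
      using near[of d] near[of "- d"] r(2) by (auto simp: inner_add_right inner_diff_right)
    then have ne: "?R \<inter> {v. a \<bullet> v > 0} \<noteq> {}" "?R \<inter> {v. a \<bullet> v < 0} \<noteq> {}" "?R \<noteq> {}" by blast+
    let ?d = "flat_dim V (insert a S)"
    have dZ: "?d (?p ?Z) = flat_dim (V \<inter> hyperplane a) S (?p ?Z)"
    proof (rule flat_dim_insert_zero)
      have "?p ?Z \<in> ?Z" using cl(3) nes(4) by (rule closest_point_in_set)
      then show "a \<bullet> ?p ?Z = 0" by simp
    qed
    \<comment> \<open>The half containing the nearest point of the cell inherits it; the other half
      then has its nearest point on the wall.\<close>
    have "(?p ?P = ?p ?K \<and> ?p ?N = ?p ?Z) \<or> (?p ?N = ?p ?K \<and> ?p ?P = ?p ?Z)"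
    proof -
      consider "a \<bullet> ?p ?K = 0" | "a \<bullet> ?p ?K > 0" | "a \<bullet> ?p ?K < 0" by linarith
      then show ?thesis
      proof cases
        case 1
        have "?p J = ?p ?K" if "J \<in> {?P, ?N, ?Z}" for J
          using that cl K 1 mem(1) by (intro closest_point_subset) auto
        then show ?thesis by simp
      next
        case 2
        have "?p ?P = ?p ?K" using cl K 2 mem(1) by (intro closest_point_subset) auto
        moreover have "a \<bullet> ?p ?N = 0" by (rule closest_point_halfspace[OF K nes(3) 2])
        then have "?p ?Z = ?p ?N" using cl mem(3) by (intro closest_point_subset) auto
        ultimately show ?thesis by simp
      next
        case 3
        have "?p ?N = ?p ?K" using cl K 3 mem(1) by (intro closest_point_subset) auto
        moreover have "(- a) \<bullet> ?p (?K \<inter> {v. (- a) \<bullet> v \<le> 0}) = 0"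
          using nes(2) 3 by (intro closest_point_halfspace[OF K]) auto
        then have "a \<bullet> ?p ?P = 0" by simp
        then have "?p ?Z = ?p ?P" using cl mem(2) by (intro closest_point_subset) auto
        ultimately show ?thesis by simp
      qed
    qed
    then show ?thesis
    proof
      assume *: "?p ?P = ?p ?K \<and> ?p ?N = ?p ?Z"
      show ?thesis unfolding cell_count_def oc cc *[THEN conjunct1] *[THEN conjunct2] dK dZ
        using ne 2 by simp
    next
      assume *: "?p ?N = ?p ?K \<and> ?p ?P = ?p ?Z"
      show ?thesis unfolding cell_count_def oc cc *[THEN conjunct1] *[THEN conjunct2] dK dZ
        using ne 2 by simp
    qed
  next
    case 3
    \<comment> \<open>If a linear form positive on the open cell were negative at \<open>u\<close>,
      it would vanish at \<open>u + e *\<^sub>R r\<close> for the \<open>e\<close> below, which is a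
      point of the open cell.\<close>
    have cell_le: "?K \<subseteq> {v. c \<bullet> v \<ge> 0}" if pos: "\<And>v. v \<in> ?R \<Longrightarrow> c \<bullet> v > 0" for c
    proof
      fix u assume u: "u \<in> ?K"
      obtain r where r: "r \<in> ?R" using 3 by blast
      show "u \<in> {v. c \<bullet> v \<ge> 0}"
      proof (rule ccontr)
        assume "u \<notin> {v. c \<bullet> v \<ge> 0}"
        then have neg: "c \<bullet> u < 0" by simp
        define e where "e = - (c \<bullet> u) / (c \<bullet> r)"
        have "e > 0" unfolding e_def using neg pos[OF r] by (intro divide_pos_pos) auto
        have "c \<bullet> (u + e *\<^sub>R r) > 0" by (rule pos[OF open_cell_add[OF V(1) u r \<open>e > 0\<close>]])
        moreover have "c \<bullet> (u + e *\<^sub>R r) = 0" using pos[OF r] by (simp add: e_def inner_add_right inner_diff_right)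
        ultimately show False by simp
      qed
    qed
    \<comment> \<open>Opposite signs at \<open>u\<close> and \<open>v\<close> would give a positive
      combination lying on the mirror and, as the open cell is a convex cone, in the cell.\<close>
    have "(\<forall>v\<in>?R. a \<bullet> v > 0) \<or> (\<forall>v\<in>?R. a \<bullet> v < 0)"
    proof (rule ccontr)
      assume "\<not> ?thesis"
      then obtain u v where uv: "u \<in> ?R" "a \<bullet> u > 0" "v \<in> ?R" "a \<bullet> v < 0"
        using 3(2) by (smt (verit, best) IntI empty_iff mem_Collect_eq)
      define e where "e = (a \<bullet> u) / - (a \<bullet> v)"
      have "e > 0" unfolding e_def using uv by (intro divide_pos_pos) auto
      moreover have "u \<in> ?K" using uv(1) by (auto simp: open_cell_def closed_cell_def less_imp_le)
      ultimately have "u + e *\<^sub>R v \<in> ?R" using uv by (intro open_cell_add[OF V(1)])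
      moreover have "a \<bullet> (u + e *\<^sub>R v) = 0" using uv by (simp add: e_def inner_add_right inner_diff_right)
      ultimately show False using 3(2) by blast
    qed
    then show ?thesis
    proof
      assume pos: "\<forall>v\<in>?R. a \<bullet> v > 0"
      then have "?P = ?K" using cell_le[of a] by blast
      moreover have "?R \<inter> {v. a \<bullet> v > 0} = ?R" "?R \<inter> {v. a \<bullet> v < 0} = {}" using pos by force+
      ultimately show ?thesis unfolding cell_count_def oc cc using 3 dK by simp
    next
      assume neg: "\<forall>v\<in>?R. a \<bullet> v < 0"
      then have "?N = ?K" using cell_le[of "- a"] by auto
      moreover have "?R \<inter> {v. a \<bullet> v < 0} = ?R" "?R \<inter> {v. a \<bullet> v > 0} = {}" using neg by force+
      ultimately show ?thesis unfolding cell_count_def oc cc using 3 dK by simp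
    qed
  qed
qed

text \<open>The flats of the restriction are those flats of the larger arrangement that involve
  \<open>a\<close>.\<close>

lemma generic_insertD:
  assumes "generic V (insert a S) x"
  shows "generic V S x" "generic (V \<inter> hyperplane a) S x"
proof -
  show "generic V S x" using assms unfolding generic_def by blast
  have "flat (V \<inter> hyperplane a) B = flat V (insert a B)" for B by (simp add: flat_insert)
  then show "generic (V \<inter> hyperplane a) S x"
    using assms unfolding generic_def by (simp only:) (meson insert_mono insertI2)
qed

text \<open>Induction over the normals with \<open>V\<close> varying. Restriction lowers
  \<open>dim V\<close> by one, so the sign turns the difference in \<open>whitney_insert\<close>
  into the sum in \<open>cell_count_cut\<close>.\<close>

theorem sum_cell_count:
  fixes V :: "'a::euclidean_space set"
  assumes "finite S" "subspace V" "generic V S x"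
  shows "int (\<Sum>T\<in>Pow S. cell_count k x V S T) = (-1) ^ (dim V + k) * coeff (whitney V S) k"
  using assms
proof (induction S arbitrary: V rule: finite_induct)
  case empty
  \<comment> \<open>The only cell is \<open>V\<close> itself, and \<open>flat_dim\<close> is
    \<open>dim V\<close> at each of its points, so the sign is an even power.\<close>
  have "open_cell V {} {} \<noteq> {}" using empty(1) subspace_0 by (auto simp: open_cell_def)
  then show ?case
    by (simp add: cell_count_def whitney_def flat_dim_def of_bool_def flip: mult_2)
next
  case (insert a S)
  note gen = generic_insertD[OF insert.prems(2)]
  have V': "subspace (V \<inter> hyperplane a)"
    using insert.prems(1) subspace_mirror by (rule subspace_inter)
  show ?case
  proof (cases "V \<subseteq> hyperplane a")
    \<comment> \<open>A mirror containing \<open>V\<close> leaves no chambers, and the two terms of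
      \<open>whitney_insert\<close> cancel.\<close>
    case True
    have "open_cell V (insert a S) T = {}" for T
      using True by (force simp: open_cell_def hyperplane_def)
    moreover have "V \<inter> hyperplane a = V" using True by blast
    ultimately show ?thesis
      using insert.hyps by (simp add: cell_count_def whitney_insert)
  next
    case False
    have inj: "inj_on (insert a) (Pow S)" using insert.hyps by (auto simp: inj_on_def)
    let ?f = "cell_count k x V (insert a S)"
    have "(\<Sum>T\<in>Pow (insert a S). ?f T) = (\<Sum>T\<in>Pow S. ?f T) + (\<Sum>T\<in>insert a ` Pow S. ?f T)"
      unfolding Pow_insert using insert.hyps by (intro sum.union_disjoint) auto
    also have "(\<Sum>T\<in>insert a ` Pow S. ?f T) = (\<Sum>T\<in>Pow S. ?f (insert a T))"
      by (simp add: sum.reindex[OF inj])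
    also have "(\<Sum>T\<in>Pow S. ?f T) + \<dots> =
        (\<Sum>T\<in>Pow S. cell_count k x V S T + cell_count k x (V \<inter> hyperplane a) S T)"
      unfolding sum.distrib[symmetric]
      using cell_count_cut[OF insert.hyps insert.prems(1) False _ insert.prems(2)]
      by (intro sum.cong refl) (simp add: add.commute)
    finally have "int (\<Sum>T\<in>Pow (insert a S). ?f T) =
        int (\<Sum>T\<in>Pow S. cell_count k x V S T) +
        int (\<Sum>T\<in>Pow S. cell_count k x (V \<inter> hyperplane a) S T)"
      by (simp add: sum.distrib)
    also have "\<dots> = (-1) ^ (dim V + k) * coeff (whitney V S) k +
        (-1) ^ (dim (V \<inter> hyperplane a) + k) * coeff (whitney (V \<inter> hyperplane a) S) k"
      using insert.IH[OF insert.prems(1) gen(1)] insert.IH[OF V' gen(2)] by presburger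
    also have "\<dots> = (-1) ^ (dim V + k) * coeff (whitney V (insert a S)) k"
      using dim_Int_hyperplane[OF insert.prems(1) False]
      by (simp add: whitney_insert[OF insert.hyps] algebra_simps)
    finally show ?thesis .
  qed
qed

section \<open>The characteristic polynomial, generic points and faces\<close>

lemma sum_alternating_Pow:
  assumes "finite A"
  shows "(\<Sum>B\<in>Pow A. (-1) ^ card B) = (if A = {} then 1 else 0 :: int)"
  using assms
proof (induction A rule: finite_induct)
  case (insert a A)
  have inj: "inj_on (insert a) (Pow A)" using insert.hyps by (auto simp: inj_on_def)
  have "(\<Sum>B\<in>Pow (insert a A). (-1) ^ card B) =
      (\<Sum>B\<in>Pow A. (-1) ^ card B) + (\<Sum>B\<in>insert a ` Pow A. (-1) ^ card B :: int)"
    unfolding Pow_insert using insert.hyps by (intro sum.union_disjoint) auto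
  also have "(\<Sum>B\<in>insert a ` Pow A. (-1) ^ card B :: int) = (\<Sum>B\<in>Pow A. - ((-1) ^ card B))"
    unfolding sum.reindex[OF inj] o_def
  proof (rule sum.cong[OF refl])
    fix B assume "B \<in> Pow A"
    then have "finite B" "a \<notin> B" using insert.hyps finite_subset by auto
    then show "(-1) ^ card (insert a B) = (- ((-1) ^ card B) :: int)" by simp
  qed
  finally show ?case by (simp add: sum_negf)
qed simp

text \<open>The right-hand side obeys the recursion of \<open>mu\<close>: summed over all
  \<open>z \<supseteq> y\<close> it is the alternating sum over the subsets of
  \<open>{H \<in> A. y \<subseteq> H}\<close>, which is 0 for \<open>y \<noteq> UNIV\<close>. As
  \<open>UNIV \<notin> A\<close>, only the empty subcollection has intersection
  \<open>UNIV\<close>.\<close>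

lemma mu_intersection_poset:
  assumes A: "finite A" "UNIV \<notin> A" and y: "y \<in> intersection_poset A"
  shows "mu (intersection_poset A) y = (\<Sum>B\<in>{B \<in> Pow A. \<Inter> B = y}. (-1) ^ card B)"
  using y
proof (induction "card {z \<in> intersection_poset A. y \<subset> z}" arbitrary: y rule: less_induct)
  case less
  let ?L = "intersection_poset A"
  let ?m = "\<lambda>y. \<Sum>B\<in>{B \<in> Pow A. \<Inter> B = y}. (-1) ^ card B :: int"
  have fin: "finite ?L" using A(1) by (rule finite_intersection_poset)
  show ?case
  proof (cases "y = UNIV")
    case True
    then have "{B \<in> Pow A. \<Inter> B = y} = {{}}" using A(2) by auto
    then show ?thesis using mu_UNIV[OF A(1)] True by simp
  next
    case False
    let ?P = "Pow {H \<in> A. y \<subseteq> H}"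
    have "(\<Sum>z\<in>{z \<in> ?L. y \<subseteq> z}. ?m z) = (\<Sum>z\<in>{z \<in> ?L. y \<subseteq> z}. \<Sum>B\<in>{B \<in> ?P. \<Inter> B = z}. (-1) ^ card B)"
      by (intro sum.cong refl) auto
    also have "\<dots> = (\<Sum>B\<in>?P. (-1) ^ card B)"
      using A(1) fin by (intro sum.group) (auto simp: intersection_poset_def)
    also have "{H \<in> A. y \<subseteq> H} \<noteq> {}"
      using less.prems False by (auto simp: intersection_poset_def)
    then have "(\<Sum>B\<in>?P. (-1) ^ card B) = (0 :: int)"
      using A(1) by (simp add: sum_alternating_Pow)
    finally have "(\<Sum>z\<in>{z \<in> ?L. y \<subseteq> z}. ?m z) = 0" .
    moreover have "(\<Sum>z\<in>{z \<in> ?L. y \<subseteq> z}. mu ?L z) = 0"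
      using A(1) less.prems False by (rule sum_mu_eq_0)
    moreover have "{z \<in> ?L. y \<subseteq> z} = insert y {z \<in> ?L. y \<subset> z}"
      using less.prems by blast
    moreover have "(\<Sum>z\<in>{z \<in> ?L. y \<subset> z}. mu ?L z) = (\<Sum>z\<in>{z \<in> ?L. y \<subset> z}. ?m z)"
    proof (rule sum.cong[OF refl])
      fix z assume z: "z \<in> {z \<in> ?L. y \<subset> z}"
      then have "{w \<in> ?L. z \<subset> w} \<subset> {w \<in> ?L. y \<subset> w}" by blast
      then have "card {w \<in> ?L. z \<subset> w} < card {w \<in> ?L. y \<subset> w}"
        using fin by (intro psubset_card_mono) auto
      then show "mu ?L z = ?m z" using less.hyps z by blast
    qed
    ultimately show ?thesis using fin by simp
  qed
qed

text \<open>Grouping by intersection turns the sum over flats into one over subcollections of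
  mirrors; these correspond to sets of normals because \<open>S\<close> has one normal per
  mirror.\<close>

lemma characteristic_poly_hyperplanes:
  fixes S :: "'a::euclidean_space set"
  assumes S: "finite S" "0 \<notin> S" "inj_on hyperplane S"
  shows "characteristic_poly (hyperplane ` S) = whitney UNIV S"
proof -
  let ?A = "hyperplane ` S"
  let ?L = "intersection_poset ?A"
  have A: "finite ?A" "UNIV \<notin> ?A"
  proof -
    have "a \<notin> hyperplane a" if "a \<in> S" for a using that S(2) by (auto simp: hyperplane_def)
    then show "UNIV \<notin> ?A" by blast
  qed (use S in simp)
  have "characteristic_poly ?A =
      (\<Sum>y\<in>?L. \<Sum>B\<in>{B \<in> Pow ?A. \<Inter> B = y}. monom ((-1) ^ card B) (dim (\<Inter> B)))"
    unfolding characteristic_poly_def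
  proof (rule sum.cong[OF refl])
    fix y assume "y \<in> ?L"
    then have "monom (mu ?L y) (dim y) = (\<Sum>B\<in>{B \<in> Pow ?A. \<Inter> B = y}. monom ((-1) ^ card B) (dim y))"
      by (simp add: mu_intersection_poset[OF A] poly_eq_iff coeff_sum)
    also have "\<dots> = (\<Sum>B\<in>{B \<in> Pow ?A. \<Inter> B = y}. monom ((-1) ^ card B) (dim (\<Inter> B)))"
      by (intro sum.cong) auto
    finally show "monom (mu ?L y) (dim y) = \<dots>" .
  qed
  also have "\<dots> = (\<Sum>B\<in>Pow ?A. monom ((-1) ^ card B) (dim (\<Inter> B)))"
    using A(1) finite_intersection_poset[OF A(1)]
    by (intro sum.group) (auto simp: intersection_poset_def)
  also have "Pow ?A = image hyperplane ` Pow S" by (rule image_Pow_surj[symmetric]) simp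
  also have "(\<Sum>B\<in>\<dots>. monom ((-1) ^ card B) (dim (\<Inter> B))) =
      (\<Sum>B\<in>Pow S. monom ((-1) ^ card (hyperplane ` B)) (dim (\<Inter> (hyperplane ` B))) :: int poly)"
    using S(3) by (subst sum.reindex) (auto intro!: inj_on_image_Pow)
  also have "\<dots> = whitney UNIV S"
    unfolding whitney_def
  proof (rule sum.cong[OF refl])
    fix B assume "B \<in> Pow S"
    then have "card (hyperplane ` B) = card B"
      using S(3) by (intro card_image) (auto intro: inj_on_subset)
    moreover have "\<Inter> (hyperplane ` B) = flat UNIV B" by (auto simp: flat_def hyperplane_def)
    ultimately show "monom ((-1) ^ card (hyperplane ` B)) (dim (\<Inter> (hyperplane ` B))) =
        (monom ((-1) ^ card B) (dim (flat UNIV B)) :: int poly)" by simp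
  qed
  finally show ?thesis .
qed

text \<open>The points violating a condition of \<open>generic\<close> are orthogonal to the projection of \<open>a\<close>
  onto the flat, which is nonzero.\<close>

lemma AE_generic:
  fixes S :: "'a::euclidean_space set"
  assumes "finite S"
  shows "AE x in lebesgue. generic UNIV S x"
proof -
  have "AE x in lebesgue. \<forall>p\<in>flat UNIV B.
      (\<forall>v\<in>flat UNIV B. (x - p) \<bullet> v = 0) \<longrightarrow> a \<bullet> p = 0 \<longrightarrow> flat UNIV B \<subseteq> hyperplane a" for B and a :: 'a
  proof (cases "flat UNIV B \<subseteq> hyperplane a")
    case False
    let ?L = "flat UNIV B"
    have L: "subspace ?L" by (simp add: subspace_flat)
    obtain c d where c: "c \<in> span ?L" "\<And>w. w \<in> span ?L \<Longrightarrow> orthogonal d w" "a = c + d"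
      using orthogonal_subspace_decomp_exists[of ?L a] by blast
    have cL: "c \<in> ?L" using c(1) L span_eq_iff by blast
    have ac: "a \<bullet> w = c \<bullet> w" if "w \<in> ?L" for w
      using c(2)[OF span_base[OF that]] c(3) by (simp add: orthogonal_def inner_add_left)
    have "c \<noteq> 0" using False ac by (auto simp: hyperplane_def)
    then have "negligible {x. c \<bullet> x = 0}" by (intro negligible_hyperplane) simp
    then have "AE x in lebesgue. x \<notin> {x. c \<bullet> x = 0}"
      by (intro AE_not_in) (simp add: negligible_iff_null_sets)
    then show ?thesis
    proof (rule AE_mp, intro AE_I2 impI ballI)
      fix x p
      assume x: "x \<notin> {x. c \<bullet> x = 0}" and p: "p \<in> ?L"
        and orth: "\<forall>v\<in>?L. (x - p) \<bullet> v = 0" and ap: "a \<bullet> p = 0"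
      have "(x - p) \<bullet> c = 0" using orth cL by blast
      then have "c \<bullet> x = c \<bullet> p" by (simp add: inner_commute[of _ c] inner_diff_right)
      also have "\<dots> = 0" using ac[OF p] ap by simp
      finally show "?L \<subseteq> hyperplane a" using x by simp
    qed
  qed simp
  then have "AE x in lebesgue. \<forall>B\<in>Pow S. \<forall>a\<in>S. \<forall>p\<in>flat UNIV B.
      (\<forall>v\<in>flat UNIV B. (x - p) \<bullet> v = 0) \<longrightarrow> a \<bullet> p = 0 \<longrightarrow> flat UNIV B \<subseteq> hyperplane a"
    by (intro AE_finite_allI[OF finite_Pow_iff[THEN iffD2, OF assms]] AE_finite_allI[OF assms])
  then show ?thesis by (rule AE_mp) (simp add: generic_def)
qed

section \<open>Chambers as sign cells and their faces\<close>

lemma convex_open_cell: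
  assumes "subspace V"
  shows "convex (open_cell V S T)"
proof -
  have "open_cell V S T = V \<inter> (\<Inter>a\<in>T. {v. a \<bullet> v > 0}) \<inter> (\<Inter>a\<in>S - T. {v. a \<bullet> v < 0})"
    by (auto simp: open_cell_def)
  also have "convex \<dots>" using assms
    by (intro convex_Int convex_INT) (auto simp: subspace_imp_convex convex_halfspace_gt convex_halfspace_lt)
  finally show ?thesis .
qed

lemma in_open_cell_signs:
  assumes "\<And>a. a \<in> S \<Longrightarrow> a \<bullet> x \<noteq> 0"
  shows "x \<in> open_cell UNIV S {a\<in>S. a \<bullet> x > 0}"
  using assms by (auto simp: open_cell_def not_less order.order_iff_strict)

text \<open>Cells are convex, hence connected, and by the intermediate value theorem a connected set
  that avoids the mirrors cannot contain points on both sides of one.\<close>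

lemma components_complement_hyperplanes:
  fixes S :: "'a::euclidean_space set"
  assumes "R \<in> components (UNIV - \<Union> (hyperplane ` S))"
  obtains T where "T \<subseteq> S" "R = open_cell UNIV S T" "R \<noteq> {}"
proof -
  let ?U = "UNIV - \<Union> (hyperplane ` S)"
  obtain x where x: "x \<in> ?U" "R = connected_component_set ?U x"
    using assms by (auto simp: components_iff)
  define T where "T = {a\<in>S. a \<bullet> x > 0}"
  have nz: "a \<bullet> y \<noteq> 0" if "a \<in> S" "y \<in> ?U" for a y using that by (auto simp: hyperplane_def)
  have xT: "x \<in> open_cell UNIV S T"
    unfolding T_def using nz x(1) by (intro in_open_cell_signs) blast
  have "open_cell UNIV S T \<subseteq> ?U"
    by (force simp: open_cell_def hyperplane_def)
  then have "open_cell UNIV S T \<subseteq> R"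
    unfolding x(2) using xT
    by (intro connected_component_maximal) (simp_all add: convex_connected convex_open_cell)
  moreover have "R \<subseteq> open_cell UNIV S T"
  proof
    fix y assume y: "y \<in> R"
    have RU: "R \<subseteq> ?U" "connected R" "x \<in> R"
      using x by (auto simp: connected_component_subset connected_connected_component)
    have "(a \<bullet> x > 0) = (a \<bullet> y > 0)" if a: "a \<in> S" for a
    proof (rule ccontr)
      assume "(a \<bullet> x > 0) \<noteq> (a \<bullet> y > 0)"
      then have "\<exists>z\<in>R. a \<bullet> z = 0"
        using connected_ivt_hyperplane[OF RU(2) RU(3) y, of a 0]
          connected_ivt_hyperplane[OF RU(2) y RU(3), of a 0]
        by (cases "a \<bullet> x > 0") auto
      then show False using nz[OF a] RU(1) by blast
    qed
    then have "T = {a\<in>S. a \<bullet> y > 0}" unfolding T_def by blast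
    then show "y \<in> open_cell UNIV S T"
      using in_open_cell_signs[of S y] nz y RU(1) by blast
  qed
  ultimately show ?thesis using that[of T] xT by (auto simp: T_def)
qed

text \<open>The points \<open>u + d *\<^sub>R r\<close> of the open cell tend to \<open>u\<close>.
  The witness \<open>r\<close> rules out the empty cell, whose closure is empty while
  \<open>closed_cell\<close> contains 0.\<close>

lemma closure_open_cell:
  fixes V :: "'a::euclidean_space set"
  assumes V: "subspace V" and r: "r \<in> open_cell V S T"
  shows "closure (open_cell V S T) = closed_cell V S T"
proof
  have "open_cell V S T \<subseteq> closed_cell V S T"
    by (auto simp: open_cell_def closed_cell_def less_imp_le)
  then show "closure (open_cell V S T) \<subseteq> closed_cell V S T"
    using closed_closed_cell[OF V] by (rule closure_minimal)
  show "closed_cell V S T \<subseteq> closure (open_cell V S T)"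
  proof
    fix u assume u: "u \<in> closed_cell V S T"
    show "u \<in> closure (open_cell V S T)"
      unfolding closure_approachable
    proof (intro allI impI)
      fix e :: real assume e: "e > 0"
      define d where "d = e / (norm r + 1)"
      have d: "d > 0" "d * norm r < e"
        using e norm_ge_zero[of r] by (auto simp: d_def field_simps add_pos_nonneg)
      have "u + d *\<^sub>R r \<in> open_cell V S T" using V u r d(1) by (rule open_cell_add)
      moreover have "dist (u + d *\<^sub>R r) u < e" using d by (simp add: dist_norm)
      ultimately show "\<exists>y\<in>open_cell V S T. dist y u < e" by blast
    qed
  qed
qed

text \<open>Near \<open>p\<close> only the constraints with \<open>a \<bullet> p = 0\<close> are
  active, so there \<open>F\<close> coincides with the smallest flat through \<open>p\<close>. Hence
  that flat is the affine hull of \<open>F\<close>, and \<open>p\<close> is a relative interior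
  point.\<close>

lemma face_of_closed_cell:
  fixes S :: "'a::euclidean_space set"
  assumes S: "finite S" and p: "p \<in> closed_cell UNIV S T" and TS: "T \<subseteq> S"
  defines "F \<equiv> closed_cell UNIV S T \<inter> flat UNIV {a\<in>S. a \<bullet> p = 0}"
  shows "F face_of closed_cell UNIV S T" "p \<in> rel_interior F" "aff_dim F = int (flat_dim UNIV S p)"
proof -
  let ?C = "closed_cell UNIV S T" and ?L = "flat UNIV {a\<in>S. a \<bullet> p = 0}"
  have L: "subspace ?L" by (simp add: subspace_flat)
  have C: "convex ?C" by (simp add: convex_closed_cell)
  show "F face_of ?C"
    unfolding face_of_def
  proof (intro conjI ballI impI)
    show "F \<subseteq> ?C" by (simp add: F_def)
    show "convex F" unfolding F_def using C subspace_imp_convex[OF L] by (rule convex_Int)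
    fix u v w assume uv: "u \<in> ?C" "v \<in> ?C" and w: "w \<in> F" "w \<in> open_segment u v"
    obtain t where t: "0 < t" "t < 1" "w = (1 - t) *\<^sub>R u + t *\<^sub>R v"
      using w(2) by (auto simp: in_segment)
    have "a \<bullet> u = 0 \<and> a \<bullet> v = 0" if a: "a \<in> S" "a \<bullet> p = 0" for a
    proof -
      have "a \<bullet> w = 0" using w(1) a by (simp add: F_def flat_def)
      then have sum0: "(1 - t) * (a \<bullet> u) + t * (a \<bullet> v) = 0" by (simp add: t(3) inner_add_right)
      \<comment> \<open>On a cell each \<open>a\<close> has one weak sign, so a proper convex
        combination of its values is zero only if both values are.\<close>
      have "(a \<bullet> u \<ge> 0 \<and> a \<bullet> v \<ge> 0) \<or> (a \<bullet> u \<le> 0 \<and> a \<bullet> v \<le> 0)"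
        using uv a by (auto simp: closed_cell_def)
      then show ?thesis
      proof
        assume *: "a \<bullet> u \<ge> 0 \<and> a \<bullet> v \<ge> 0"
        then have "(1 - t) * (a \<bullet> u) \<ge> 0" "t * (a \<bullet> v) \<ge> 0" using t by simp_all
        then have "(1 - t) * (a \<bullet> u) = 0" "t * (a \<bullet> v) = 0" using sum0 by linarith+
        then show ?thesis using t by simp
      next
        assume *: "a \<bullet> u \<le> 0 \<and> a \<bullet> v \<le> 0"
        then have "(1 - t) * (a \<bullet> u) \<le> 0" "t * (a \<bullet> v) \<le> 0"
          using t by (simp_all add: mult_nonneg_nonpos)
        then have "(1 - t) * (a \<bullet> u) = 0" "t * (a \<bullet> v) = 0" using sum0 by linarith+
        then show ?thesis using t by simp
      qed
    qed
    then show "u \<in> F" "v \<in> F" using uv by (auto simp: F_def flat_def)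
  qed
  \<comment> \<open>A neighbourhood of \<open>p\<close> on which the constraints inactive at
    \<open>p\<close> keep their strict signs.\<close>
  define U where "U = (\<Inter>a\<in>{a\<in>S. a \<bullet> p > 0}. {v. a \<bullet> v > 0}) \<inter> (\<Inter>a\<in>{a\<in>S. a \<bullet> p < 0}. {v. a \<bullet> v < 0})"
  have U: "open U" "p \<in> U"
    using S by (auto simp: U_def open_halfspace_gt open_halfspace_lt intro!: open_Int open_INT)
  have pF: "p \<in> F" using p by (simp add: F_def flat_def)
  have sub: "?L \<inter> U \<subseteq> F"
  proof
    fix v assume v: "v \<in> ?L \<inter> U"
    have "a \<bullet> v \<ge> 0" if "a \<in> T" for a
    proof (cases "a \<bullet> p = 0")
      case True
      then show ?thesis using v that TS by (auto simp: flat_def)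
    next
      case False
      then have "a \<bullet> p > 0" "a \<in> S" using p that TS by (auto simp: closed_cell_def order.order_iff_strict)
      then show ?thesis using v by (auto simp: U_def less_imp_le)
    qed
    moreover have "a \<bullet> v \<le> 0" if "a \<in> S - T" for a
    proof (cases "a \<bullet> p = 0")
      case True
      then show ?thesis using v that by (auto simp: flat_def)
    next
      case False
      then have "a \<bullet> p < 0" "a \<in> S" using p that by (auto simp: closed_cell_def order.order_iff_strict)
      then show ?thesis using v by (auto simp: U_def less_imp_le)
    qed
    ultimately show "v \<in> F" using v by (simp add: F_def closed_cell_def)
  qed
  have "affine hull (?L \<inter> U) = affine hull ?L"
    using affine_hull_affine_Int_open[of ?L U] L U pF
    by (auto simp: F_def subspace_imp_affine)
  also have "\<dots> = ?L" using L by (simp add: subspace_imp_affine)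
  finally have "?L \<subseteq> affine hull F" using hull_mono[OF sub, of affine] by simp
  moreover have "affine hull F \<subseteq> ?L"
    by (rule hull_minimal) (auto simp: F_def L subspace_imp_affine)
  ultimately have aff: "affine hull F = ?L" by blast
  then show "p \<in> rel_interior F"
    unfolding mem_rel_interior using U pF sub by blast
  have "aff_dim F = aff_dim ?L" using aff by (metis aff_dim_affine_hull)
  then show "aff_dim F = int (flat_dim UNIV S p)"
    using L by (simp add: aff_dim_subspace flat_dim_def)
qed

text \<open>Two faces whose relative interiors share a point coincide, so the face in
  \<open>projection_has_dim\<close> must be that of \<open>face_of_closed_cell\<close>.\<close>

lemma projection_has_dim_closed_cell:
  fixes S :: "'a::euclidean_space set"
  assumes "finite S" "T \<subseteq> S"
  shows "projection_has_dim (closed_cell UNIV S T) y k \<longleftrightarrow>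
    flat_dim UNIV S (closest_point (closed_cell UNIV S T) y) = k"
proof -
  let ?C = "closed_cell UNIV S T"
  let ?p = "closest_point ?C y"
  have p: "?p \<in> ?C" by (simp add: closest_point_in_closed_cell)
  note F = face_of_closed_cell[OF assms(1) p assms(2)]
  show ?thesis
  proof
    assume "projection_has_dim ?C y k"
    then obtain G where G: "G face_of ?C" "aff_dim G = int k" "?p \<in> rel_interior G"
      by (auto simp: projection_has_dim_def)
    then have "G = ?C \<inter> flat UNIV {a\<in>S. a \<bullet> ?p = 0}"
      using F(1,2) by (intro face_of_eq) auto
    then show "flat_dim UNIV S ?p = k" using F(3) G(2) by simp
  next
    assume "flat_dim UNIV S ?p = k"
    then show "projection_has_dim ?C y k"
      unfolding projection_has_dim_def using F by blast
  qed
qed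

section \<open>Simple transitivity on the chambers\<close>

text \<open>With \<open>c\<close> the coefficient of the projection of \<open>a\<close> onto
  \<open>b\<close>, the remainder is orthogonal to \<open>b\<close>, hence to \<open>a\<close>,
  hence to itself.\<close>

lemma hyperplane_eq_imp_multiple:
  fixes a b :: "'a::real_inner"
  assumes "hyperplane a = hyperplane b" "a \<noteq> 0" "b \<noteq> 0"
  obtains c where "c \<noteq> 0" "a = c *\<^sub>R b"
proof -
  define c where "c = (b \<bullet> a) / (b \<bullet> b)"
  have "a - c *\<^sub>R b \<in> hyperplane b"
    using assms(3) by (simp add: hyperplane_def inner_diff_right c_def)
  then have "b \<bullet> (a - c *\<^sub>R b) = 0" "a \<bullet> (a - c *\<^sub>R b) = 0"
    using assms(1) by (simp_all add: hyperplane_def set_eq_iff)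
  then have "(a - c *\<^sub>R b) \<bullet> (a - c *\<^sub>R b) = 0" by (simp add: inner_diff_left)
  then have "a = c *\<^sub>R b" by simp
  with that assms(2) show ?thesis by force
qed

lemma reflection_eq_self_iff: "reflection a x = x \<longleftrightarrow> x \<in> hyperplane a"
  by (auto simp: reflection_def hyperplane_def)

text \<open>The properties of the three groups on which the count rests. Identity and inverses
  follow from closure, finiteness and injectivity; \<open>free\<close> says that points off the
  mirrors have trivial stabilisers.\<close>

locale finite_orthogonal_group =
  fixes W :: "('a::euclidean_space \<Rightarrow> 'a) set"
  assumes finite_W: "finite W"
    and W_nonempty: "W \<noteq> {}"
    and orthogonal: "g \<in> W \<Longrightarrow> orthogonal_transformation g"
    and comp_closed: "g \<in> W \<Longrightarrow> h \<in> W \<Longrightarrow> g \<circ> h \<in> W"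
    and free: "g \<in> W \<Longrightarrow> z \<notin> \<Union> (reflection_arrangement W) \<Longrightarrow> g z = z \<Longrightarrow> g = id"
begin

lemma linear: "g \<in> W \<Longrightarrow> linear g"
  using orthogonal by (simp add: orthogonal_transformation_linear)

lemma inner: "g \<in> W \<Longrightarrow> g u \<bullet> g v = u \<bullet> v"
  using orthogonal by (simp add: orthogonal_transformation_def)

lemma inj: "g \<in> W \<Longrightarrow> inj g"
  using orthogonal by (simp add: orthogonal_transformation_inj)

lemma comp_image:
  assumes "g \<in> W"
  shows "(\<circ>) g ` W = W"
proof (rule endo_inj_surj[OF finite_W])
  show "inj_on ((\<circ>) g) W" using inj[OF assms] by (auto intro!: inj_onI dest: fun.inj_map_strong simp: fun_eq_iff inj_eq)
qed (use assms comp_closed in blast)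

lemma id_in: "id \<in> W"
proof -
  obtain g where g: "g \<in> W" using W_nonempty by blast
  then obtain h where h: "h \<in> W" "g = g \<circ> h" using comp_image[OF g] by blast
  have "h x = x" for x using fun_cong[OF h(2), of x] inj[OF g] by (simp add: inj_eq)
  then have "h = id" by auto
  with h(1) show ?thesis by simp
qed

lemma inverse:
  assumes "g \<in> W"
  shows "\<exists>h\<in>W. (\<forall>x. g (h x) = x) \<and> (\<forall>x. h (g x) = x)"
proof -
  obtain h where h: "h \<in> W" "g \<circ> h = id" using comp_image[OF assms] id_in by (metis imageE)
  then have gh: "g (h x) = x" for x by (simp add: fun_eq_iff)
  then have "h (g x) = x" for x using inj[OF assms] by (metis injD)
  with h(1) gh show ?thesis by blast
qed

lemma finite_arrangement: "finite (reflection_arrangement W)"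
proof -
  have "reflection_arrangement W \<subseteq> (\<lambda>g. {x. g x = x}) ` W"
  proof
    fix H assume "H \<in> reflection_arrangement W"
    then obtain a where a: "H = hyperplane a" "reflection a \<in> W"
      unfolding reflection_arrangement_def by blast
    then have "H = {x. reflection a x = x}" by (simp add: reflection_eq_self_iff)
    then show "H \<in> (\<lambda>g. {x. g x = x}) ` W" using a(2) by (rule image_eqI)
  qed
  then show ?thesis using finite_W finite_surj by blast
qed

lemma exists_normals:
  obtains S where "finite S" "0 \<notin> S" "inj_on hyperplane S" "hyperplane ` S = reflection_arrangement W"
    "\<And>a. a \<in> S \<Longrightarrow> reflection a \<in> W"
proof -
  have "reflection_arrangement W \<subseteq> hyperplane ` {a. a \<noteq> 0 \<and> reflection a \<in> W}"
    by (auto simp: reflection_arrangement_def)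
  then obtain S where S: "S \<subseteq> {a. a \<noteq> 0 \<and> reflection a \<in> W}" "inj_on hyperplane S"
      "reflection_arrangement W = hyperplane ` S"
    unfolding subset_image_inj by blast
  moreover have "finite S" using S(2,3) finite_arrangement by (simp add: finite_image_iff)
  ultimately show ?thesis using that[of S] by auto
qed

end

locale finite_orthogonal_group_normals = finite_orthogonal_group W
  for W :: "('a::euclidean_space \<Rightarrow> 'a) set" +
  fixes S :: "'a set"
  assumes S: "finite S" "0 \<notin> S" "inj_on hyperplane S" "hyperplane ` S = reflection_arrangement W"
    and reflection_in: "a \<in> S \<Longrightarrow> reflection a \<in> W"
begin

text \<open>Conjugating \<open>reflection a\<close> by \<open>g\<close> gives
  \<open>reflection (g a)\<close>, so \<open>g a\<close> is normal to a mirror, though it may be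
  only a multiple of the chosen normal.\<close>

lemma normal_image:
  assumes g: "g \<in> W" and a: "a \<in> S"
  shows "\<exists>b\<in>S. \<exists>c. c \<noteq> 0 \<and> g a = c *\<^sub>R b"
proof -
  obtain h where h: "h \<in> W" "\<And>x. g (h x) = x" "\<And>x. h (g x) = x" using inverse[OF g] by blast
  have eq: "reflection (g a) = g \<circ> (reflection a \<circ> h)"
  proof
    fix x
    have "g a \<bullet> x = a \<bullet> h x" using inner[OF g, of a "h x"] h(2) by simp
    then show "reflection (g a) x = (g \<circ> (reflection a \<circ> h)) x"
      using linear[OF g] h(2) inner[OF g, of a a]
      by (simp add: reflection_def linear_diff linear_cmul)
  qed
  then have "reflection (g a) \<in> W" using g h(1) reflection_in[OF a] by (simp add: comp_closed)
  moreover have "g a \<bullet> g a \<noteq> 0" using inner[OF g] a S(2) by auto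
  then have nz: "g a \<noteq> 0" by auto
  ultimately have "hyperplane (g a) \<in> hyperplane ` S"
    unfolding S(4) reflection_arrangement_def by blast
  then obtain b where b: "b \<in> S" "hyperplane (g a) = hyperplane b" by blast
  have "b \<noteq> 0" using b(1) S(2) by auto
  obtain c where "c \<noteq> 0" "g a = c *\<^sub>R b"
    using hyperplane_eq_imp_multiple[OF b(2) nz \<open>b \<noteq> 0\<close>] by blast
  then show ?thesis using b(1) by blast
qed

lemma normal_preimage:
  assumes g: "g \<in> W" and b: "b \<in> S"
  shows "\<exists>a\<in>S. \<exists>c. c \<noteq> 0 \<and> g a = c *\<^sub>R b"
proof -
  obtain h where h: "h \<in> W" "\<And>x. g (h x) = x" "\<And>x. h (g x) = x" using inverse[OF g] by blast
  obtain a c where a: "a \<in> S" "c \<noteq> 0" "h b = c *\<^sub>R a" using normal_image[OF h(1) b] by blast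
  have "b = c *\<^sub>R g a" using h(2)[of b] a(3) linear[OF g] by (simp add: linear_cmul)
  then have "g a = (1 / c) *\<^sub>R b" using a(2) by simp
  then show ?thesis using a(1,2) by (intro bexI[of _ a] exI[of _ "1 / c"]) simp_all
qed

lemma regular_iff: "z \<notin> \<Union> (reflection_arrangement W) \<longleftrightarrow> (\<forall>a\<in>S. a \<bullet> z \<noteq> 0)"
  unfolding S(4)[symmetric] by (auto simp: hyperplane_def)

text \<open>\<open>g\<close> permutes the mirrors but not necessarily the chosen normals, so the
  statements transported along it are those invariant under nonzero scaling.\<close>

lemma all_normals_image:
  assumes g: "g \<in> W" and P: "\<And>c b. c \<noteq> 0 \<Longrightarrow> P (c *\<^sub>R b) \<longleftrightarrow> P b"
  shows "(\<forall>a\<in>S. P (g a)) \<longleftrightarrow> (\<forall>b\<in>S. P b)"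
proof
  show "\<forall>b\<in>S. P b" if "\<forall>a\<in>S. P (g a)" 
  proof
    fix b assume "b \<in> S"
    then obtain a c where a: "a \<in> S" "c \<noteq> 0" "g a = c *\<^sub>R b" using normal_preimage[OF g] by blast
    have "P (g a)" using that a(1) by blast
    then show "P b" using P[OF a(2)] a(3) by simp
  qed
  show "\<forall>a\<in>S. P (g a)" if "\<forall>b\<in>S. P b" 
  proof
    fix a assume "a \<in> S"
    then obtain b c where b: "b \<in> S" "c \<noteq> 0" "g a = c *\<^sub>R b" using normal_image[OF g] by blast
    have "P b" using that b(1) by blast
    then show "P (g a)" using P[OF b(2)] b(3) by simp
  qed
qed

text \<open>By orthogonality \<open>g\<close> maps the smallest flat through \<open>p\<close> onto
  the one through \<open>g p\<close>.\<close>

lemma flat_dim_image: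
  assumes g: "g \<in> W"
  shows "flat_dim UNIV S (g p) = flat_dim UNIV S p"
proof -
  have "g ` flat UNIV {a\<in>S. a \<bullet> p = 0} = flat UNIV {a\<in>S. a \<bullet> g p = 0}"
  proof -
    have iff: "g v \<in> flat UNIV {a\<in>S. a \<bullet> g p = 0} \<longleftrightarrow> v \<in> flat UNIV {a\<in>S. a \<bullet> p = 0}" for v
    proof -
      have "(\<forall>a\<in>S. g a \<bullet> g p = 0 \<longrightarrow> g a \<bullet> g v = 0) \<longleftrightarrow> (\<forall>b\<in>S. b \<bullet> g p = 0 \<longrightarrow> b \<bullet> g v = 0)"
        using g by (rule all_normals_image) simp
      then show ?thesis unfolding flat_def by (simp add: inner[OF g]) blast
    qed
    obtain h where "h \<in> W" "\<And>x. g (h x) = x" "\<And>x. h (g x) = x" using inverse[OF g] by blast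
    note h = this
    show ?thesis
    proof (intro equalityI subsetI)
      fix w assume "w \<in> flat UNIV {a\<in>S. a \<bullet> g p = 0}"
      then have "h w \<in> flat UNIV {a\<in>S. a \<bullet> p = 0}" using iff[of "h w"] h(2) by simp
      then show "w \<in> g ` flat UNIV {a\<in>S. a \<bullet> p = 0}" using h(2)[of w] by (metis imageI)
    qed (use iff in blast)
  qed
  then have "flat_dim UNIV S (g p) = dim (g ` flat UNIV {a\<in>S. a \<bullet> p = 0})"
    by (simp add: flat_dim_def)
  also have "\<dots> = flat_dim UNIV S p"
    unfolding flat_dim_def using linear[OF g] inj[OF g]
    by (intro dim_image_eq) (auto intro: inj_on_subset)
  finally show ?thesis .
qed

end

section \<open>Chambers indexed by group elements\<close>

lemma open_cell_index_eq:
  assumes "r \<in> open_cell V S T" "T \<subseteq> S"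
  shows "T = {a\<in>S. a \<bullet> r > 0}"
proof (intro equalityI subsetI)
  fix a assume a: "a \<in> {a\<in>S. a \<bullet> r > 0}"
  show "a \<in> T"
  proof (rule ccontr)
    assume "a \<notin> T"
    then have "a \<bullet> r < 0" using assms(1) a by (simp add: open_cell_def)
    then show False using a by simp
  qed
qed (use assms in \<open>auto simp: open_cell_def\<close>)

text \<open>When \<open>f\<close> is linear, the product form of the sign conditions is invariant
  under nonzero scaling of a normal, as \<open>all_normals_image\<close> requires.\<close>

lemma open_cell_sign_iff:
  assumes "\<And>a. a \<in> S \<Longrightarrow> f a \<noteq> (0 :: real)"
  shows "v \<in> open_cell UNIV S {a\<in>S. f a > 0} \<longleftrightarrow> (\<forall>a\<in>S. (a \<bullet> v) * f a > 0)"
proof -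
  have "(a \<bullet> v) * f a > 0 \<longleftrightarrow> (if f a > 0 then a \<bullet> v > 0 else a \<bullet> v < 0)" if "a \<in> S" for a
    using assms[OF that] by (auto simp: zero_less_mult_iff)
  then show ?thesis by (auto simp: open_cell_def)
qed

lemma closed_cell_sign_iff:
  assumes "\<And>a. a \<in> S \<Longrightarrow> f a \<noteq> (0 :: real)"
  shows "v \<in> closed_cell UNIV S {a\<in>S. f a > 0} \<longleftrightarrow> (\<forall>a\<in>S. (a \<bullet> v) * f a \<ge> 0)"
proof -
  have "(a \<bullet> v) * f a \<ge> 0 \<longleftrightarrow> (if f a > 0 then a \<bullet> v \<ge> 0 else a \<bullet> v \<le> 0)" if "a \<in> S" for a
    using assms[OF that] by (auto simp: zero_le_mult_iff)
  then show ?thesis by (auto simp: closed_cell_def)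
qed

text \<open>\<open>g\<close> maps the chamber indexed by \<open>index g\<close> onto the one indexed by \<open>T0\<close>.\<close>

locale chamber = finite_orthogonal_group_normals W S
  for W :: "('a::euclidean_space \<Rightarrow> 'a) set" and S +
  fixes T0 :: "'a set" and r0 :: 'a
  assumes T0: "T0 \<subseteq> S" and r0: "r0 \<in> open_cell UNIV S T0"
begin

definition index :: "('a \<Rightarrow> 'a) \<Rightarrow> 'a set" where
  "index g = {a\<in>S. g a \<bullet> r0 > 0}"

lemma r0_nonzero: "a \<in> S \<Longrightarrow> a \<bullet> r0 \<noteq> 0"
  using r0 by (force simp: open_cell_def)

lemma T0_eq: "T0 = {a\<in>S. a \<bullet> r0 > 0}"
  using r0 T0 by (rule open_cell_index_eq)

lemma open_cell_T0_iff: "v \<in> open_cell UNIV S T0 \<longleftrightarrow> (\<forall>a\<in>S. (a \<bullet> v) * (a \<bullet> r0) > 0)"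
  unfolding T0_eq by (rule open_cell_sign_iff) (rule r0_nonzero)

lemma closed_cell_T0_iff: "v \<in> closed_cell UNIV S T0 \<longleftrightarrow> (\<forall>a\<in>S. (a \<bullet> v) * (a \<bullet> r0) \<ge> 0)"
  unfolding T0_eq by (rule closed_cell_sign_iff) (rule r0_nonzero)

lemma image_r0_nonzero: "g \<in> W \<Longrightarrow> a \<in> S \<Longrightarrow> g a \<bullet> r0 \<noteq> 0"
  using normal_image[of g a] by (auto simp: r0_nonzero)

text \<open>By orthogonality \<open>g a \<bullet> r0\<close> is the inner product of
  \<open>a\<close> with the preimage of \<open>r0\<close> under \<open>g\<close>, so
  \<open>index g\<close> is the sign vector of that preimage.\<close>

lemma open_cell_index_iff:
  assumes g: "g \<in> W"
  shows "v \<in> open_cell UNIV S (index g) \<longleftrightarrow> g v \<in> open_cell UNIV S T0"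
proof -
  have "v \<in> open_cell UNIV S (index g) \<longleftrightarrow> (\<forall>a\<in>S. (a \<bullet> v) * (g a \<bullet> r0) > 0)"
    unfolding index_def by (rule open_cell_sign_iff) (rule image_r0_nonzero[OF g])
  also have "\<dots> \<longleftrightarrow> (\<forall>a\<in>S. (g a \<bullet> g v) * (g a \<bullet> r0) > 0)" by (simp add: inner[OF g])
  also have "\<dots> \<longleftrightarrow> (\<forall>b\<in>S. (b \<bullet> g v) * (b \<bullet> r0) > 0)"
    using g
  proof (rule all_normals_image)
    fix c :: real and b assume "c \<noteq> 0"
    \<comment> \<open>Scaling \<open>b\<close> by \<open>c\<close> multiplies the product by
      \<open>c * c\<close>.\<close>
    then have "c * c > 0" using not_real_square_gt_zero[of c] by blast
    then show "((c *\<^sub>R b) \<bullet> g v) * ((c *\<^sub>R b) \<bullet> r0) > 0 \<longleftrightarrow> (b \<bullet> g v) * (b \<bullet> r0) > 0"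
      using mult_less_cancel_left_pos[of "c * c" 0 "(b \<bullet> g v) * (b \<bullet> r0)"]
      by (simp add: algebra_simps)
  qed
  finally show ?thesis by (simp add: open_cell_T0_iff)
qed

lemma closed_cell_index_iff:
  assumes g: "g \<in> W"
  shows "v \<in> closed_cell UNIV S (index g) \<longleftrightarrow> g v \<in> closed_cell UNIV S T0"
proof -
  have "v \<in> closed_cell UNIV S (index g) \<longleftrightarrow> (\<forall>a\<in>S. (a \<bullet> v) * (g a \<bullet> r0) \<ge> 0)"
    unfolding index_def by (rule closed_cell_sign_iff) (rule image_r0_nonzero[OF g])
  also have "\<dots> \<longleftrightarrow> (\<forall>a\<in>S. (g a \<bullet> g v) * (g a \<bullet> r0) \<ge> 0)" by (simp add: inner[OF g])
  also have "\<dots> \<longleftrightarrow> (\<forall>b\<in>S. (b \<bullet> g v) * (b \<bullet> r0) \<ge> 0)"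
    using g
  proof (rule all_normals_image)
    fix c :: real and b assume "c \<noteq> 0"
    then have "c * c > 0" using not_real_square_gt_zero[of c] by blast
    then show "((c *\<^sub>R b) \<bullet> g v) * ((c *\<^sub>R b) \<bullet> r0) \<ge> 0 \<longleftrightarrow> (b \<bullet> g v) * (b \<bullet> r0) \<ge> 0"
      using mult_le_cancel_left_pos[of "c * c" 0 "(b \<bullet> g v) * (b \<bullet> r0)"]
      by (simp add: algebra_simps)
  qed
  finally show ?thesis by (simp add: closed_cell_T0_iff)
qed

text \<open>The sum of the images of \<open>r0\<close> under the stabiliser of the chamber lies in the chamber and
  is fixed by the stabiliser, which is therefore trivial.\<close>

lemma stabiliser_trivial:
  assumes u: "u \<in> W" and stab: "\<And>v. v \<in> open_cell UNIV S T0 \<Longrightarrow> u v \<in> open_cell UNIV S T0"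
  shows "u = id"
proof -
  let ?R = "open_cell UNIV S T0"
  define K where "K = {g\<in>W. \<forall>v\<in>?R. g v \<in> ?R}"
  define z where "z = (\<Sum>g\<in>K. g r0)"
  have K: "finite K" "id \<in> K" using finite_W id_in by (auto simp: K_def)
  have inj_u: "inj_on ((\<circ>) u) K"
    using inj[OF u] by (auto intro!: inj_onI simp: fun_eq_iff inj_eq)
  have "(\<circ>) u ` K = K"
    using u stab comp_closed by (intro endo_inj_surj[OF K(1) _ inj_u]) (auto simp: K_def)
  moreover have "u z = (\<Sum>g\<in>K. (u \<circ> g) r0)"
    unfolding z_def using linear[OF u] by (simp add: linear_sum)
  then have "u z = (\<Sum>g\<in>(\<circ>) u ` K. g r0)" by (simp add: sum.reindex[OF inj_u])
  ultimately have fix_z: "u z = z" by (simp add: z_def)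
  have "a \<bullet> z \<noteq> 0" if a: "a \<in> S" for a
  proof -
    have "(a \<bullet> z) * (a \<bullet> r0) = (\<Sum>g\<in>K. (a \<bullet> g r0) * (a \<bullet> r0))"
      by (simp add: z_def inner_sum_right sum_distrib_right)
    also have "\<dots> > 0"
      using K a r0 by (intro sum_pos) (auto simp: K_def open_cell_T0_iff)
    finally show ?thesis by auto
  qed
  then show ?thesis using free[OF u _ fix_z] regular_iff by blast
qed

text \<open>If \<open>g\<close> and \<open>h\<close> have the same index, then \<open>g\<close>
  after the inverse of \<open>h\<close> maps the chamber of \<open>T0\<close> into itself.\<close>

lemma inj_on_index: "inj_on index W"
proof (rule inj_onI)
  fix g h assume gh: "g \<in> W" "h \<in> W" "index g = index h"
  obtain k where k: "k \<in> W" "\<And>x. h (k x) = x" "\<And>x. k (h x) = x" using inverse[OF gh(2)] by blast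
  have "g \<circ> k = id"
  proof (rule stabiliser_trivial)
    show "g \<circ> k \<in> W" using gh k comp_closed by blast
    fix v assume "v \<in> open_cell UNIV S T0"
    then show "(g \<circ> k) v \<in> open_cell UNIV S T0"
      using open_cell_index_iff[OF gh(1), of "k v"] open_cell_index_iff[OF gh(2), of "k v"] gh(3) k(2)
      by simp
  qed
  then have "g (k (h x)) = h x" for x by (simp add: fun_eq_iff)
  then show "g = h" by (auto simp: k(3))
qed

text \<open>An orbit point with maximal inner product with \<open>r0\<close> lies on the same side of each mirror
  as \<open>r0\<close>, as otherwise reflecting it would increase the inner product.\<close>

lemma orbit_meets_chamber:
  assumes y: "\<And>a. a \<in> S \<Longrightarrow> a \<bullet> y \<noteq> 0"
  obtains g where "g \<in> W" "g y \<in> open_cell UNIV S T0"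
proof -
  have "Max ((\<lambda>g. g y \<bullet> r0) ` W) \<in> (\<lambda>g. g y \<bullet> r0) ` W"
    using finite_W W_nonempty by (intro Max_in) simp_all
  then obtain g where g: "g \<in> W" "Max ((\<lambda>g. g y \<bullet> r0) ` W) = g y \<bullet> r0" by blast
  have max: "h y \<bullet> r0 \<le> g y \<bullet> r0" if "h \<in> W" for h
    unfolding g(2)[symmetric] using finite_W that by (intro Max_ge) simp_all
  have "(a \<bullet> g y) * (a \<bullet> r0) > 0" if a: "a \<in> S" for a
  proof -
    have "(reflection a \<circ> g) y \<bullet> r0 \<le> g y \<bullet> r0" 
      by (rule max[OF comp_closed[OF reflection_in[OF a] g(1)]])
    then have "2 * (a \<bullet> g y) / (a \<bullet> a) * (a \<bullet> r0) \<ge> 0"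
      by (simp add: reflection_def inner_diff_left)
    moreover have "a \<bullet> a > 0" using a S(2) by auto
    ultimately have "(a \<bullet> g y) * (a \<bullet> r0) \<ge> 0" by (simp add: zero_le_divide_iff mult.commute)
    \<comment> \<open>As \<open>g\<close> permutes the mirrors, \<open>g y\<close> lies off them
      too, which makes the inequality strict.\<close>
    moreover have "a \<bullet> g y \<noteq> 0"
    proof -
      obtain b c where b: "b \<in> S" "c \<noteq> 0" "g b = c *\<^sub>R a" using normal_preimage[OF g(1) a] by blast
      have "c * (a \<bullet> g y) = b \<bullet> y" using inner[OF g(1), of b y] b(3) by simp
      then show ?thesis using y[OF b(1)] by auto
    qed
    ultimately show ?thesis using r0_nonzero[OF a] by (simp add: order.order_iff_strict)
  qed
  then show ?thesis using that[of g] g(1) open_cell_T0_iff by blast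
qed

text \<open>The cell of \<open>index g\<close> contains the preimage of \<open>r0\<close>;
  conversely, a point of any chamber is moved into that of \<open>T0\<close> by some
  \<open>g\<close>, whose index is then that chamber's sign vector.\<close>

lemma index_image: "index ` W = {T \<in> Pow S. open_cell UNIV S T \<noteq> {}}"
proof (intro equalityI subsetI)
  fix T assume "T \<in> index ` W"
  then obtain g where g: "g \<in> W" "T = index g" by blast
  obtain h where h: "h \<in> W" "\<And>x. g (h x) = x" "\<And>x. h (g x) = x" using inverse[OF g(1)] by blast
  then have "h r0 \<in> open_cell UNIV S T" using g r0 by (simp add: open_cell_index_iff)
  then show "T \<in> {T \<in> Pow S. open_cell UNIV S T \<noteq> {}}" using g by (auto simp: index_def)
next
  fix T assume "T \<in> {T \<in> Pow S. open_cell UNIV S T \<noteq> {}}"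
  then obtain y where y: "T \<subseteq> S" "y \<in> open_cell UNIV S T" by blast
  have "a \<bullet> y \<noteq> 0" if "a \<in> S" for a using y that by (force simp: open_cell_def)
  then obtain g where g: "g \<in> W" "g y \<in> open_cell UNIV S T0" using orbit_meets_chamber by blast
  then have "y \<in> open_cell UNIV S (index g)" by (simp add: open_cell_index_iff)
  moreover have "index g \<subseteq> S" by (auto simp: index_def)
  ultimately have "index g = {a\<in>S. a \<bullet> y > 0}" by (rule open_cell_index_eq)
  also have "\<dots> = T" using y(2,1) by (rule open_cell_index_eq[symmetric])
  finally have "T = index g" by (rule sym)
  then show "T \<in> index ` W" using g by blast
qed

text \<open>\<open>g\<close> is an isometry carrying the chamber of \<open>index g\<close> onto that
  of \<open>T0\<close>, so it preserves the obtuse-angle inequality.\<close>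

lemma closest_point_image:
  assumes g: "g \<in> W"
  shows "closest_point (closed_cell UNIV S T0) (g x) = g (closest_point (closed_cell UNIV S (index g)) x)"
    (is "closest_point ?C _ = g ?p")
proof (rule closest_point_eqI)
  show "closed ?C" "convex ?C" by (simp_all add: closed_closed_cell convex_closed_cell)
  show "g ?p \<in> ?C"
    using closest_point_in_closed_cell[of UNIV S "index g" x] by (simp add: closed_cell_index_iff[OF g])
  fix y assume y: "y \<in> ?C"
  obtain h where h: "h \<in> W" "\<And>x. g (h x) = x" "\<And>x. h (g x) = x" using inverse[OF g] by blast
  have "(x - ?p) \<bullet> (h y - ?p) \<le> 0"
    using y h by (intro closest_point_dot)
      (simp_all add: closed_closed_cell convex_closed_cell closed_cell_index_iff[OF g])
  moreover have "(g x - g ?p) \<bullet> (y - g ?p) = (x - ?p) \<bullet> (h y - ?p)"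
    using inner[OF g, of "x - ?p" "h y - ?p"] linear[OF g] h by (simp add: linear_diff)
  ultimately show "(g x - g ?p) \<bullet> (y - g ?p) \<le> 0" by simp
qed

text \<open>Via the bijection \<open>index\<close>, projecting \<open>g x\<close> onto the fixed
  chamber becomes projecting the fixed \<open>x\<close> onto the chamber of
  \<open>index g\<close>.\<close>

lemma card_projection_dim:
  "card {g \<in> W. projection_has_dim (closed_cell UNIV S T0) (g x) k} =
    (\<Sum>T\<in>Pow S. cell_count k x UNIV S T)"
proof -
  let ?Q = "\<lambda>T. open_cell UNIV S T \<noteq> {} \<and>
    flat_dim UNIV S (closest_point (closed_cell UNIV S T) x) = k"
  have "projection_has_dim (closed_cell UNIV S T0) (g x) k \<longleftrightarrow> ?Q (index g)" if "g \<in> W" for g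
    using that index_image
    by (auto simp: projection_has_dim_closed_cell[OF S(1) T0] closest_point_image flat_dim_image)
  then have "index ` {g \<in> W. projection_has_dim (closed_cell UNIV S T0) (g x) k} =
      {T \<in> index ` W. ?Q T}"
    by blast
  also have "\<dots> = {T \<in> Pow S. ?Q T}" unfolding index_image by blast
  finally have image: "index ` {g \<in> W. projection_has_dim (closed_cell UNIV S T0) (g x) k} =
      {T \<in> Pow S. ?Q T}" .
  have "inj_on index {g \<in> W. projection_has_dim (closed_cell UNIV S T0) (g x) k}"
    using inj_on_index by (rule inj_on_subset) simp
  then have "card {g \<in> W. projection_has_dim (closed_cell UNIV S T0) (g x) k} =
      card {T \<in> Pow S. ?Q T}"
    unfolding image[symmetric] by (rule card_image[symmetric])
  also have "\<dots> = (\<Sum>T\<in>Pow S. cell_count k x UNIV S T)"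
    using S(1) by (simp add: cell_count_def of_bool_def sum.If_cases Int_def)
  finally show ?thesis .
qed

end

theorem (in finite_orthogonal_group) AE_card_projection_dim:
  assumes "fundamental_chamber W C"
  shows "AE x in lebesgue. \<forall>k. int (card {g \<in> W. projection_has_dim C (g x) k}) =
    \<bar>coeff (characteristic_poly (reflection_arrangement W)) k\<bar>"
proof -
  obtain S where S: "finite S" "0 \<notin> S" "inj_on hyperplane S"
      "hyperplane ` S = reflection_arrangement W" "\<And>a. a \<in> S \<Longrightarrow> reflection a \<in> W"
    using exists_normals by blast
  obtain R where R: "R \<in> components (UNIV - \<Union> (hyperplane ` S))" "C = closure R"
    using assms unfolding fundamental_chamber_def S(4) by blast
  then obtain T0 where T0: "T0 \<subseteq> S" "R = open_cell UNIV S T0" "R \<noteq> {}"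
    using components_complement_hyperplanes by blast
  then obtain r0 where r0: "r0 \<in> open_cell UNIV S T0" by blast
  have C: "C = closed_cell UNIV S T0"
    using closure_open_cell[OF subspace_UNIV r0] R(2) T0(2) by simp
  interpret chamber W S T0 r0
    by unfold_locales (use S T0 r0 in auto)
  have "int (card {g \<in> W. projection_has_dim C (g x) k}) =
      \<bar>coeff (characteristic_poly (reflection_arrangement W)) k\<bar>" if gen: "generic UNIV S x" for x k
  proof -
    have eq: "int (card {g \<in> W. projection_has_dim C (g x) k}) =
        (-1) ^ (dim (UNIV :: 'a set) + k) * coeff (whitney UNIV S) k"
      unfolding C card_projection_dim using S(1) subspace_UNIV gen by (rule sum_cell_count)
    \<comment> \<open>A count is its own absolute value, and absolute values discard the sign in
      \<open>sum_cell_count\<close>.\<close>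
    have "int (card {g \<in> W. projection_has_dim C (g x) k}) = \<bar>\<dots>\<bar>"
      unfolding eq[symmetric] by simp
    also have "\<dots> = \<bar>coeff (characteristic_poly (reflection_arrangement W)) k\<bar>"
      using characteristic_poly_hyperplanes[OF S(1-3)] S(4) by (simp add: abs_mult power_abs)
    finally show ?thesis .
  qed
  then show ?thesis using AE_generic[OF S(1)] by (rule_tac AE_mp) auto
qed

section \<open>Signed permutations\<close>

lemma signed_perm_comp: "signed_perm s p \<circ> signed_perm t q = signed_perm (\<lambda>i. s i * t (p i)) (q \<circ> p)"
  by (auto simp: signed_perm_def fun_eq_iff vec_eq_iff)

lemma orthogonal_signed_perm:
  fixes p :: "'n::finite \<Rightarrow> 'n"
  assumes s: "\<forall>i. s i \<in> {-1, 1}" and p: "p permutes UNIV"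
  shows "orthogonal_transformation (signed_perm s p)"
proof -
  have "linear (signed_perm s p)"
    by (rule linearI) (auto simp: signed_perm_def vec_eq_iff algebra_simps)
  moreover have "signed_perm s p u \<bullet> signed_perm s p v = u \<bullet> v" for u v
  proof -
    have ss: "s i * s i = 1" for i using s[rule_format, of i] by auto
    have "signed_perm s p u \<bullet> signed_perm s p v = (\<Sum>i\<in>UNIV. (s i * s i) * (u $ p i * v $ p i))"
      by (simp add: signed_perm_def inner_vec_def algebra_simps)
    also have "\<dots> = (\<Sum>i\<in>UNIV. u $ p i * v $ p i)" by (simp only: ss mult_1)
    also have "\<dots> = u \<bullet> v"
      unfolding inner_vec_def using sum.permute[OF p, of "\<lambda>i. u $ i * v $ i"] by (simp add: o_def)
    finally show ?thesis .
  qed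
  ultimately show ?thesis by (simp add: orthogonal_transformation_def)
qed

text \<open>The product of the signs is multiplicative, which gives closure of \<open>type_D\<close>
  under composition.\<close>

lemma even_card_negative_iff_prod:
  fixes s :: "'n::finite \<Rightarrow> real"
  assumes "\<forall>i. s i \<in> {-1, 1}"
  shows "even (card {i. s i = -1}) \<longleftrightarrow> (\<Prod>i\<in>UNIV. s i) = 1"
proof -
  have "(\<Prod>i\<in>UNIV. s i) = (\<Prod>i\<in>UNIV. if s i = -1 then -1 else 1)"
    using assms by (intro prod.cong) auto
  also have "\<dots> = (-1) ^ card {i. s i = -1}" by (simp add: prod.If_cases)
  finally show ?thesis by (simp add: minus_one_power_iff)
qed

lemma finite_type_B: "finite (type_B :: (real ^ 'n \<Rightarrow> real ^ 'n) set)"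
proof -
  have "type_B \<subseteq> (\<lambda>(s, p). signed_perm s p) `
      (PiE UNIV (\<lambda>_. {-1, 1 :: real}) \<times> {p :: 'n \<Rightarrow> 'n. p permutes UNIV})"
    by (auto simp: type_B_def PiE_UNIV_domain)
  then show ?thesis
    by (rule finite_subset) (intro finite_imageI finite_cartesian_product finite_PiE; simp add: finite_permutations)
qed

lemma type_A_subset_B: "type_A \<subseteq> type_B"
  unfolding type_A_def type_B_def by blast

lemma type_D_subset_B: "type_D \<subseteq> type_B"
  unfolding type_D_def type_B_def by blast

lemma orthogonal_type_B: "g \<in> type_B \<Longrightarrow> orthogonal_transformation g"
  unfolding type_B_def using orthogonal_signed_perm by blast

lemma id_signed_perm: "id = signed_perm (\<lambda>_. 1) id"
  by (auto simp: signed_perm_def vec_eq_iff)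

lemma id_in_type_A: "id \<in> type_A"
  unfolding type_A_def id_signed_perm using permutes_id by blast

lemma id_in_type_D: "id \<in> type_D"
proof -
  have "even (card {i :: 'n. (1 :: real) = -1})" by simp
  then show ?thesis unfolding type_D_def id_signed_perm using permutes_id by blast
qed

lemma comp_type_A: "g \<in> type_A \<Longrightarrow> h \<in> type_A \<Longrightarrow> g \<circ> h \<in> type_A"
  unfolding type_A_def by (auto simp: signed_perm_comp intro: permutes_compose)

lemma sign_mult:
  assumes "\<forall>i. s i \<in> {-1, 1 :: real}" "\<forall>i. t i \<in> {-1, 1}"
  shows "\<forall>i. s i * t (p i) \<in> {-1, 1}"
proof
  fix i show "s i * t (p i) \<in> {-1, 1}"
    using assms(1)[rule_format, of i] assms(2)[rule_format, of "p i"] by auto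
qed

lemma comp_type_B:
  assumes "g \<in> type_B" "h \<in> type_B"
  shows "g \<circ> h \<in> type_B"
proof -
  obtain s p where g: "g = signed_perm s p" "\<forall>i. s i \<in> {-1, 1}" "p permutes UNIV"
    using assms(1) unfolding type_B_def by blast
  obtain t q where h: "h = signed_perm t q" "\<forall>i. t i \<in> {-1, 1}" "q permutes UNIV"
    using assms(2) unfolding type_B_def by blast
  show ?thesis
    unfolding type_B_def g(1) h(1) signed_perm_comp
    using sign_mult[OF g(2) h(2)] permutes_compose[OF g(3) h(3)] by blast
qed

lemma comp_type_D:
  assumes "g \<in> type_D" "h \<in> type_D"
  shows "g \<circ> h \<in> type_D"
proof -
  obtain s p where g: "g = signed_perm s p" "\<forall>i. s i \<in> {-1, 1}" "p permutes UNIV"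
      "even (card {i. s i = -1})"
    using assms(1) unfolding type_D_def by blast
  obtain t q where h: "h = signed_perm t q" "\<forall>i. t i \<in> {-1, 1}" "q permutes UNIV"
      "even (card {i. t i = -1})"
    using assms(2) unfolding type_D_def by blast
  have "(\<Prod>i\<in>UNIV. s i * t (p i)) = (\<Prod>i\<in>UNIV. s i) * (\<Prod>i\<in>UNIV. t i)"
    using prod.permute[OF g(3), of t] by (simp add: prod.distrib o_def)
  also have "\<dots> = 1"
    using g(2,4) h(2,4) by (simp add: even_card_negative_iff_prod)
  finally have "even (card {i. s i * t (p i) = -1})"
    using even_card_negative_iff_prod[OF sign_mult[OF g(2) h(2)]] by simp
  then show ?thesis
    unfolding type_D_def g(1) h(1) signed_perm_comp
    using sign_mult[OF g(2) h(2)] permutes_compose[OF g(3) h(3)] by blast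
qed

section \<open>Trivial stabilisers off the mirrors\<close>

text \<open>Fixing \<open>z\<close> equates \<open>z $ i\<close> with \<open>z $ p i\<close> up to
  sign, which is excluded unless \<open>p i = i\<close>. The premise \<open>neg\<close> is asked
  only where \<open>s i = -1\<close>, so that the lemma also serves type A, whose arrangement lacks
  the mirrors \<open>x $ i = - x $ j\<close>.\<close>

lemma signed_perm_fixes_regular:
  fixes z :: "real ^ 'n"
  assumes s: "\<forall>i. s i \<in> {-1, 1}" and fix_z: "signed_perm s p z = z"
    and z: "\<And>i j. i \<noteq> j \<Longrightarrow> z $ i \<noteq> z $ j"
    and neg: "\<And>i j. s i = -1 \<Longrightarrow> i \<noteq> j \<Longrightarrow> z $ i \<noteq> - z $ j"
  shows "p = id" "s i = -1 \<Longrightarrow> z $ i = 0"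
proof -
  have eq: "s i * z $ p i = z $ i" for i
    using fix_z by (simp add: signed_perm_def vec_eq_iff)
  have pid: "p i = i" for i
  proof (rule ccontr)
    assume "p i \<noteq> i"
    then show False using eq[of i] z[of i "p i"] neg[of i "p i"] s[rule_format, of i] by auto
  qed
  then show "p = id" by auto
  show "z $ i = 0" if "s i = -1" using eq[of i] that pid[of i] by simp
qed

lemma free_type_A:
  fixes z :: "real ^ 'n"
  assumes g: "g \<in> type_A" and z: "z \<notin> \<Union> (reflection_arrangement type_A)" and fix_z: "g z = z"
  shows "g = id"
proof -
  obtain p where p: "g = signed_perm (\<lambda>_. 1) p" using g by (auto simp: type_A_def)
  have "z $ i \<noteq> z $ j" if "i \<noteq> j" for i j
    using z that unfolding reflection_arrangement_A by blast
  then have "p = id" using fix_z p by (intro signed_perm_fixes_regular(1)) auto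
  then show ?thesis by (simp add: p id_signed_perm)
qed

lemma free_type_B:
  fixes z :: "real ^ 'n"
  assumes g: "g \<in> type_B" and z: "z \<notin> \<Union> (reflection_arrangement type_B)" and fix_z: "g z = z"
  shows "g = id"
proof -
  obtain s p where sp: "g = signed_perm s p" "\<forall>i. s i \<in> {-1, 1}"
    using g unfolding type_B_def by blast
  have reg: "z $ i \<noteq> z $ j" "z $ i \<noteq> - z $ j" if "i \<noteq> j" for i j
    using z that unfolding reflection_arrangement_B by blast+
  have "z $ i \<noteq> 0" for i using z unfolding reflection_arrangement_B by blast
  then have "p = id" "s i \<noteq> -1" for i
    using signed_perm_fixes_regular[OF sp(2) fix_z[unfolded sp(1)] reg] by blast+
  then have "p = id" "s = (\<lambda>_. 1)" using sp(2) by auto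
  then show ?thesis by (simp add: sp(1) id_signed_perm)
qed

text \<open>Coordinate hyperplanes are no mirrors here, so \<open>z\<close> may have a zero
  coordinate. Distinctness allows only one, hence at most one sign change, and evenness excludes
  exactly one.\<close>

lemma free_type_D:
  fixes z :: "real ^ 'n"
  assumes g: "g \<in> type_D" and z: "z \<notin> \<Union> (reflection_arrangement type_D)" and fix_z: "g z = z"
  shows "g = id"
proof -
  obtain s p where sp: "g = signed_perm s p" "\<forall>i. s i \<in> {-1, 1}" "even (card {i. s i = -1})"
    using g unfolding type_D_def by blast
  have reg: "z $ i \<noteq> z $ j" "z $ i \<noteq> - z $ j" if "i \<noteq> j" for i j
    using z that unfolding reflection_arrangement_D by blast+
  note fixed = signed_perm_fixes_regular[OF sp(2) fix_z[unfolded sp(1)] reg]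
  have "s i \<noteq> -1" for i
  proof
    assume i: "s i = -1"
    then have "{i. s i = -1} = {i}" using fixed(2) reg(1) by force
    then show False using sp(3) by simp
  qed
  then have "s = (\<lambda>_. 1)" using sp(2) by auto
  then show ?thesis using fixed(1) by (simp add: sp(1) id_signed_perm)
qed

lemma finite_orthogonal_group_types:
  fixes W :: "(real ^ 'n \<Rightarrow> real ^ 'n) set"
  assumes "W = type_A \<or> W = type_B \<or> W = type_D"
  shows "finite_orthogonal_group W"
proof
  have sub: "W \<subseteq> type_B" using assms type_A_subset_B type_D_subset_B by blast
  then show "finite W" using finite_type_B by (rule finite_subset)
  show "orthogonal_transformation g" if "g \<in> W" for g
    using sub that orthogonal_type_B by blast
  show "W \<noteq> {}" using assms id_in_type_A id_in_type_D type_A_subset_B by blast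
  show "g \<circ> h \<in> W" if "g \<in> W" "h \<in> W" for g h
    using assms that comp_type_A comp_type_B comp_type_D by blast
  show "g = id" if "g \<in> W" "z \<notin> \<Union> (reflection_arrangement W)" "g z = z" for g z
    using assms that free_type_A free_type_B free_type_D by blast
qed

theorem theorem4:
  fixes W :: "(real ^ 'n \<Rightarrow> real ^ 'n) set" and C :: "(real ^ 'n) set"
  assumes "W = type_A \<or> W = type_B \<or> W = type_D"
    and "fundamental_chamber W C"
  shows "AE x in lebesgue. x \<in> C \<longrightarrow>
    (\<forall>k. int (card {g \<in> W. projection_has_dim C (g x) k}) =
         \<bar>coeff (characteristic_poly (reflection_arrangement W)) k\<bar>)"
  using finite_orthogonal_group.AE_card_projection_dim[OF finite_orthogonal_group_types[OF assms(1)] assms(2)]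
  by (rule AE_mp) simp

end
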